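(* Let $B$ be an arithmetic variety of dimension $d+1$ and $\mathcal M$ a smoothly metrized line sheaf on $B$. Let $c_{12}>c_{11}>0$ and $m_0\in\mathbb Z$ be such that $c_{11}m^{d+1}\le h^0(B,\mathcal M^{\otimes m})\le c_{12}m^{d+1}$ for all integers $m\ge m_0$. Let $h$ and $b$ be positive integers, let $M,N$ be positive integers, and let $A$ be an $M\times N$ matrix with entries in $H^0(B,\mathcal M^{\otimes h}\otimes\mathcal V_{-\log N})$. Assume $b\ge m_0$ and $$\left(1+\frac hb\right)^{d+1}<\frac{Nc_{11}}{Mc_{12}}.$$ Then there is a nonzero vector $\mathbf v\in H^0(B,\mathcal M^{\otimes b}\otimes\mathcal V_{\log2})^N$ such that $A\mathbf v=\mathbf 0$ in $H^0(B,\mathcal M_{\mathrm{fin}}^{\otimes(h+b)})^M$.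
   Context: An arithmetic variety is an integral scheme, flat and projective over $\mathrm{Spec}\,\mathbb Z$. A smoothly metrized line sheaf $\mathcal L$ is a line sheaf $\mathcal L_{\mathrm{fin}}$ with a smooth conjugation-invariant hermitian metric on its pull-back to $B(\mathbb C)$. $H^0(B,\mathcal L)$ denotes the finite set of small sections $\{s\in H^0(B,\mathcal L_{\mathrm{fin}}):\sup_{B(\mathbb C)}\|s\|\le1\}$ and $h^0(B,\mathcal L)=\log\#H^0(B,\mathcal L)$. For $a\in\mathbb R$, $\mathcal V_a$ is $\mathcal O_B$ with the metric in which the section $1$ has constant norm $e^{-a}$ (so $H^0(B,\mathcal L\otimes\mathcal V_a)$ consists of sections of $\mathcal L_{\mathrm{fin}}$ with sup norm $\le e^{a}$). In the paper $\mathcal M$ is ample, which guarantees existence of such $c_{11},c_{12},m_0$. *)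

theory Defs
  imports
    "HOL-Analysis.Analysis"
    "HOL-Algebra.Module"
    "HOL-Algebra.IntRing"
    "HOL-Library.Poly_Mapping"
    "HOL-Library.Extended_Nat"
begin

section \<open>Sheaves, germs and ringed spaces\<close>

definition is_sheaf ::
  "'p topology \<Rightarrow> ('p set \<Rightarrow> 'a set) \<Rightarrow> ('p set \<Rightarrow> 'p set \<Rightarrow> 'a \<Rightarrow> 'a) \<Rightarrow> bool" where
  "is_sheaf T F res \<longleftrightarrow>
     (\<forall>U V. openin T U \<longrightarrow> openin T V \<longrightarrow> V \<subseteq> U \<longrightarrow> res U V \<in> F U \<rightarrow> F V) \<and>
     (\<forall>U. openin T U \<longrightarrow> (\<forall>s\<in>F U. res U U s = s)) \<and>
     (\<forall>U V W. openin T U \<longrightarrow> openin T V \<longrightarrow> openin T W \<longrightarrow> W \<subseteq> V \<longrightarrow> V \<subseteq> U \<longrightarrow>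
        (\<forall>s\<in>F U. res V W (res U V s) = res U W s)) \<and>
     (\<forall>\<U> s. (\<forall>U\<in>\<U>. openin T U \<and> s U \<in> F U) \<longrightarrow>
        (\<forall>U\<in>\<U>. \<forall>V\<in>\<U>. res U (U \<inter> V) (s U) = res V (U \<inter> V) (s V)) \<longrightarrow>
        (\<exists>!t. t \<in> F (\<Union>\<U>) \<and> (\<forall>U\<in>\<U>. res (\<Union>\<U>) U t = s U)))"

definition germ ::
  "'p topology \<Rightarrow> ('p set \<Rightarrow> 'a set) \<Rightarrow> ('p set \<Rightarrow> 'p set \<Rightarrow> 'a \<Rightarrow> 'a) \<Rightarrow>
   'p \<Rightarrow> 'p set \<Rightarrow> 'a \<Rightarrow> ('p set \<times> 'a) set" where
  "germ T F res x U s =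
     {(V, t). openin T V \<and> x \<in> V \<and> t \<in> F V \<and>
        (\<exists>W. openin T W \<and> x \<in> W \<and> W \<subseteq> U \<inter> V \<and> res U W s = res V W t)}"

definition germs ::
  "'p topology \<Rightarrow> ('p set \<Rightarrow> 'a set) \<Rightarrow> ('p set \<Rightarrow> 'p set \<Rightarrow> 'a \<Rightarrow> 'a) \<Rightarrow>
   'p \<Rightarrow> ('p set \<times> 'a) set set" where
  "germs T F res x = {germ T F res x U s |U s. openin T U \<and> x \<in> U \<and> s \<in> F U}"

record ('p, 'r) rspace =
  rtop :: "'p topology"
  rsec :: "'p set \<Rightarrow> 'r ring"
  rres :: "'p set \<Rightarrow> 'p set \<Rightarrow> 'r \<Rightarrow> 'r"

definition ringed_space :: "('p, 'r) rspace \<Rightarrow> bool" where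
  "ringed_space X \<longleftrightarrow>
     (\<forall>U. openin (rtop X) U \<longrightarrow> cring (rsec X U)) \<and>
     (\<forall>U V. openin (rtop X) U \<longrightarrow> openin (rtop X) V \<longrightarrow> V \<subseteq> U \<longrightarrow>
        rres X U V \<in> ring_hom (rsec X U) (rsec X V)) \<and>
     is_sheaf (rtop X) (\<lambda>U. carrier (rsec X U)) (rres X)"

definition rgerm :: "('p, 'r) rspace \<Rightarrow> 'p \<Rightarrow> 'p set \<Rightarrow> 'r \<Rightarrow> ('p set \<times> 'r) set" where
  "rgerm X = germ (rtop X) (\<lambda>U. carrier (rsec X U)) (rres X)"

definition stalk :: "('p, 'r) rspace \<Rightarrow> 'p \<Rightarrow> ('p set \<times> 'r) set ring" where
  "stalk X x =
     \<lparr>carrier = germs (rtop X) (\<lambda>U. carrier (rsec X U)) (rres X) x,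
      mult = (\<lambda>a b. \<Union>(U, s)\<in>a. \<Union>(V, t)\<in>b. rgerm X x (U \<inter> V)
        (rres X U (U \<inter> V) s \<otimes>\<^bsub>rsec X (U \<inter> V)\<^esub> rres X V (U \<inter> V) t)),
      one = rgerm X x (topspace (rtop X)) \<one>\<^bsub>rsec X (topspace (rtop X))\<^esub>,
      zero = rgerm X x (topspace (rtop X)) \<zero>\<^bsub>rsec X (topspace (rtop X))\<^esub>,
      add = (\<lambda>a b. \<Union>(U, s)\<in>a. \<Union>(V, t)\<in>b. rgerm X x (U \<inter> V)
        (rres X U (U \<inter> V) s \<oplus>\<^bsub>rsec X (U \<inter> V)\<^esub> rres X V (U \<inter> V) t))\<rparr>"

definition preim :: "('p, 'r) rspace \<Rightarrow> ('p \<Rightarrow> 'q) \<Rightarrow> 'q set \<Rightarrow> 'p set" where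
  "preim X f V = {x \<in> topspace (rtop X). f x \<in> V}"

definition ringed_morphism ::
  "('p, 'r) rspace \<Rightarrow> ('q, 't) rspace \<Rightarrow> ('p \<Rightarrow> 'q) \<Rightarrow> ('q set \<Rightarrow> 't \<Rightarrow> 'r) \<Rightarrow> bool" where
  "ringed_morphism X Y f \<phi> \<longleftrightarrow>
     continuous_map (rtop X) (rtop Y) f \<and>
     (\<forall>V. openin (rtop Y) V \<longrightarrow> \<phi> V \<in> ring_hom (rsec Y V) (rsec X (preim X f V))) \<and>
     (\<forall>V W. openin (rtop Y) V \<longrightarrow> openin (rtop Y) W \<longrightarrow> W \<subseteq> V \<longrightarrow>
        (\<forall>s\<in>carrier (rsec Y V).
           \<phi> W (rres Y V W s) = rres X (preim X f V) (preim X f W) (\<phi> V s)))"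

definition ringed_isomorphic :: "('p, 'r) rspace \<Rightarrow> ('q, 't) rspace \<Rightarrow> bool" where
  "ringed_isomorphic X Y \<longleftrightarrow>
     (\<exists>f \<phi>. ringed_morphism X Y f \<phi> \<and> homeomorphic_map (rtop X) (rtop Y) f \<and>
        (\<forall>V. openin (rtop Y) V \<longrightarrow>
           bij_betw (\<phi> V) (carrier (rsec Y V)) (carrier (rsec X (preim X f V)))))"

definition open_subspace :: "('p, 'r) rspace \<Rightarrow> 'p set \<Rightarrow> ('p, 'r) rspace" where
  "open_subspace X U = X\<lparr>rtop := subtopology (rtop X) U\<rparr>"


section \<open>Spectra, projective space and schemes\<close>

text \<open>
  \<open>F\<close> is the set of admissible fractions \<open>(a, f)\<close>, read as \<open>a / f\<close>: all pairs for a spectrum, and pairs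
  of homogeneous elements of equal degree for a projective spectrum. \<open>frac R F q a f\<close> is the class
  of \<open>a / f\<close> in the localization (respectively its degree 0 part) at the prime \<open>q\<close>.
\<close>

definition frac :: "'a ring \<Rightarrow> ('a \<times> 'a) set \<Rightarrow> 'a set \<Rightarrow> 'a \<Rightarrow> 'a \<Rightarrow> ('a \<times> 'a) set" where
  "frac R F q a f =
     {(b, g) \<in> F. g \<notin> q \<and> (\<exists>t\<in>carrier R - q. t \<otimes>\<^bsub>R\<^esub> (a \<otimes>\<^bsub>R\<^esub> g) = t \<otimes>\<^bsub>R\<^esub> (b \<otimes>\<^bsub>R\<^esub> f))}"

definition frac_sections ::
  "'a ring \<Rightarrow> ('a \<times> 'a) set \<Rightarrow> 'a set topology \<Rightarrow> 'a set set \<Rightarrow>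
   ('a set \<Rightarrow> ('a \<times> 'a) set) ring" where
  "frac_sections R F T U =
     \<lparr>carrier = {s \<in> extensional U. \<forall>p\<in>U. \<exists>V a f. openin T V \<and> p \<in> V \<and> V \<subseteq> U \<and> (a, f) \<in> F \<and>
        (\<forall>q\<in>V. f \<notin> q \<and> s q = frac R F q a f)},
      mult = (\<lambda>s t. \<lambda>q\<in>U. \<Union>(a, f)\<in>s q. \<Union>(b, g)\<in>t q.
        frac R F q (a \<otimes>\<^bsub>R\<^esub> b) (f \<otimes>\<^bsub>R\<^esub> g)),
      one = (\<lambda>q\<in>U. frac R F q \<one>\<^bsub>R\<^esub> \<one>\<^bsub>R\<^esub>),
      zero = (\<lambda>q\<in>U. frac R F q \<zero>\<^bsub>R\<^esub> \<one>\<^bsub>R\<^esub>),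
      add = (\<lambda>s t. \<lambda>q\<in>U. \<Union>(a, f)\<in>s q. \<Union>(b, g)\<in>t q.
        frac R F q (a \<otimes>\<^bsub>R\<^esub> g \<oplus>\<^bsub>R\<^esub> b \<otimes>\<^bsub>R\<^esub> f) (f \<otimes>\<^bsub>R\<^esub> g))\<rparr>"

definition frac_space ::
  "'a ring \<Rightarrow> ('a \<times> 'a) set \<Rightarrow> 'a set topology \<Rightarrow> ('a set, 'a set \<Rightarrow> ('a \<times> 'a) set) rspace" where
  "frac_space R F T =
     \<lparr>rtop = T, rsec = frac_sections R F T, rres = (\<lambda>U V s. restrict s V)\<rparr>"

definition spec :: "'a ring \<Rightarrow> ('a set, 'a set \<Rightarrow> ('a \<times> 'a) set) rspace" where
  "spec R = frac_space R (carrier R \<times> carrier R)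
     (topology_generated_by {{p. primeideal p R \<and> f \<notin> p} |f. f \<in> carrier R})"

text \<open>
  A scheme is a ringed space that is locally isomorphic to a spectrum; locality of the stalks is
  then automatic. The ring can be taken with elements in the type of the sections, because
  it is isomorphic to the ring of sections over the affine open set.
\<close>

definition scheme :: "('p, 'r) rspace \<Rightarrow> bool" where
  "scheme X \<longleftrightarrow> ringed_space X \<and>
     (\<forall>x\<in>topspace (rtop X). \<exists>U (R :: 'r ring). openin (rtop X) U \<and> x \<in> U \<and> cring R \<and>
        ringed_isomorphic (open_subspace X U) (spec R))"

definition integral_scheme :: "('p, 'r) rspace \<Rightarrow> bool" where
  "integral_scheme X \<longleftrightarrow> scheme X \<and> topspace (rtop X) \<noteq> {} \<and>
     (\<forall>U. openin (rtop X) U \<longrightarrow> U \<noteq> {} \<longrightarrow> domain (rsec X U))"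

definition closed_immersion ::
  "('p, 'r) rspace \<Rightarrow> ('q, 't) rspace \<Rightarrow> ('p \<Rightarrow> 'q) \<Rightarrow> ('q set \<Rightarrow> 't \<Rightarrow> 'r) \<Rightarrow> bool" where
  "closed_immersion X Y f \<phi> \<longleftrightarrow> ringed_morphism X Y f \<phi> \<and>
     \<comment> \<open>the maps on stalks are local homomorphisms\<close>
     (\<forall>V s x U. openin (rtop Y) V \<longrightarrow> s \<in> carrier (rsec Y V) \<longrightarrow>
        openin (rtop X) U \<longrightarrow> x \<in> U \<longrightarrow> U \<subseteq> preim X f V \<longrightarrow>
        rres X (preim X f V) U (\<phi> V s) \<in> Units (rsec X U) \<longrightarrow>
        (\<exists>W. openin (rtop Y) W \<and> f x \<in> W \<and> W \<subseteq> V \<and> rres Y V W s \<in> Units (rsec Y W))) \<and>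
     embedding_map (rtop X) (rtop Y) f \<and> closedin (rtop Y) (f ` topspace (rtop X)) \<and>
     \<comment> \<open>the map from the structure sheaf of \<open>Y\<close> to the direct image is surjective as a map of sheaves\<close>
     (\<forall>V t y. openin (rtop Y) V \<longrightarrow> y \<in> V \<longrightarrow> t \<in> carrier (rsec X (preim X f V)) \<longrightarrow>
        (\<exists>W. openin (rtop Y) W \<and> y \<in> W \<and> W \<subseteq> V \<and>
           (\<exists>s\<in>carrier (rsec Y W). \<phi> W s = rres X (preim X f V) (preim X f W) t)))"

type_synonym zpoly = "(nat \<Rightarrow>\<^sub>0 nat) \<Rightarrow>\<^sub>0 int"

definition type_ring :: "'a::comm_ring_1 ring" where
  "type_ring = \<lparr>carrier = UNIV, mult = (*), one = 1, zero = 0, add = (+)\<rparr>"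

definition zpoly_ring :: "nat \<Rightarrow> zpoly ring" where
  "zpoly_ring n = type_ring
     \<lparr>carrier := {f. \<forall>m\<in>Poly_Mapping.keys f. Poly_Mapping.keys m \<subseteq> {..n}}\<rparr>"

definition zpoly_homog :: "nat \<Rightarrow> nat \<Rightarrow> zpoly set" where
  "zpoly_homog n k = {f \<in> carrier (zpoly_ring n). \<forall>m\<in>Poly_Mapping.keys f.
     (\<Sum>i\<in>Poly_Mapping.keys m. Poly_Mapping.lookup m i) = k}"

definition proj_space_points :: "nat \<Rightarrow> zpoly set set" where
  "proj_space_points n =
     {p. primeideal p (zpoly_ring n) \<and>
         p = genideal (zpoly_ring n) (p \<inter> (\<Union>k. zpoly_homog n k)) \<and>
         \<not> (\<Union>k\<in>{1..}. zpoly_homog n k) \<subseteq> p}"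

definition proj_space :: "nat \<Rightarrow> (zpoly set, zpoly set \<Rightarrow> (zpoly \<times> zpoly) set) rspace" where
  "proj_space n = frac_space (zpoly_ring n)
     (\<Union>k. zpoly_homog n k \<times> zpoly_homog n k)
     (topology_generated_by
        {{p \<in> proj_space_points n. f \<notin> p} |f. f \<in> (\<Union>k. zpoly_homog n k)})"

definition projective_over_Z :: "('p, 'r) rspace \<Rightarrow> bool" where
  "projective_over_Z X \<longleftrightarrow> (\<exists>n f \<phi>. closed_immersion X (proj_space n) f \<phi>)"

text \<open>
  Lists of pairs are formal finite sums of pure tensors, so lists modulo \<open>bitensor_eq R M N\<close> form the
  tensor product of \<open>M\<close> and \<open>N\<close> over \<open>R\<close>.
\<close>

inductive bitensor_eq ::
  "'a ring \<Rightarrow> ('a, 'm) module \<Rightarrow> ('a, 'n) module \<Rightarrow> ('m \<times> 'n) list \<Rightarrow> ('m \<times> 'n) list \<Rightarrow> bool"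
  for R M N where
  refl: "E \<in> lists (carrier M \<times> carrier N) \<Longrightarrow> bitensor_eq R M N E E"
| sym: "bitensor_eq R M N E F \<Longrightarrow> bitensor_eq R M N F E"
| trans: "bitensor_eq R M N E F \<Longrightarrow> bitensor_eq R M N F G \<Longrightarrow> bitensor_eq R M N E G"
| cong: "bitensor_eq R M N E E' \<Longrightarrow> bitensor_eq R M N F F' \<Longrightarrow> bitensor_eq R M N (E @ F) (E' @ F')"
| comm: "E \<in> lists (carrier M \<times> carrier N) \<Longrightarrow> F \<in> lists (carrier M \<times> carrier N) \<Longrightarrow>
    bitensor_eq R M N (E @ F) (F @ E)"
| zero: "y \<in> carrier N \<Longrightarrow> bitensor_eq R M N [(\<zero>\<^bsub>M\<^esub>, y)] []"
| add_left: "x \<in> carrier M \<Longrightarrow> x' \<in> carrier M \<Longrightarrow> y \<in> carrier N \<Longrightarrow>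
    bitensor_eq R M N [(x \<oplus>\<^bsub>M\<^esub> x', y)] [(x, y), (x', y)]"
| add_right: "x \<in> carrier M \<Longrightarrow> y \<in> carrier N \<Longrightarrow> y' \<in> carrier N \<Longrightarrow>
    bitensor_eq R M N [(x, y \<oplus>\<^bsub>N\<^esub> y')] [(x, y), (x, y')]"
| balanced: "r \<in> carrier R \<Longrightarrow> x \<in> carrier M \<Longrightarrow> y \<in> carrier N \<Longrightarrow>
    bitensor_eq R M N [(r \<odot>\<^bsub>M\<^esub> x, y)] [(x, r \<odot>\<^bsub>N\<^esub> y)]"

definition ideal_module :: "'a ring \<Rightarrow> 'a set \<Rightarrow> ('a, 'a) module" where
  "ideal_module R I =
     \<lparr>carrier = I, mult = mult R, one = \<one>\<^bsub>R\<^esub>, zero = \<zero>\<^bsub>R\<^esub>, add = add R, smult = mult R\<rparr>"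

text \<open>\<open>M\<close> is flat iff the map from the tensor product of \<open>I\<close> and \<open>M\<close> to \<open>M\<close> is injective for every ideal \<open>I\<close>.\<close>

definition flat_module :: "'a ring \<Rightarrow> ('a, 'm) module \<Rightarrow> bool" where
  "flat_module R M \<longleftrightarrow> Module.module R M \<and>
     (\<forall>I E. ideal I R \<longrightarrow> E \<in> lists (I \<times> carrier M) \<longrightarrow>
        foldr (\<lambda>(i, x) y. i \<odot>\<^bsub>M\<^esub> x \<oplus>\<^bsub>M\<^esub> y) E \<zero>\<^bsub>M\<^esub> = \<zero>\<^bsub>M\<^esub> \<longrightarrow>
        bitensor_eq R (ideal_module R I) M E [])"

definition int_module :: "'a ring \<Rightarrow> (int, 'a) module" where
  "int_module R =
     \<lparr>carrier = carrier R, mult = mult R, one = \<one>\<^bsub>R\<^esub>, zero = \<zero>\<^bsub>R\<^esub>, add = add R,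
      smult = (\<lambda>k x. add_pow R k x)\<rparr>"

text \<open>
  The base point under \<open>x\<close> has as local ring a localization of the integers, and over such a ring
  flatness is the same as flatness over the integers.
\<close>

definition flat_over_Z :: "('p, 'r) rspace \<Rightarrow> bool" where
  "flat_over_Z X \<longleftrightarrow>
     (\<forall>x\<in>topspace (rtop X). flat_module int_ring (int_module (stalk X x)))"

definition arithmetic_variety :: "('p, 'r) rspace \<Rightarrow> bool" where
  "arithmetic_variety X \<longleftrightarrow> integral_scheme X \<and> flat_over_Z X \<and> projective_over_Z X"

definition irreducible_closed :: "'p topology \<Rightarrow> 'p set \<Rightarrow> bool" where
  "irreducible_closed T Z \<longleftrightarrow> closedin T Z \<and> Z \<noteq> {} \<and>
     (\<forall>Z1 Z2. closedin T Z1 \<longrightarrow> closedin T Z2 \<longrightarrow> Z = Z1 \<union> Z2 \<longrightarrow> Z = Z1 \<or> Z = Z2)"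

definition krull_dim :: "'p topology \<Rightarrow> enat" where
  "krull_dim T = Sup {enat n |n. \<exists>Z. (\<forall>i\<le>n. irreducible_closed T (Z i)) \<and> (\<forall>i<n. Z i \<subset> Z (Suc i))}"


section \<open>Complex points\<close>

text \<open>
  A morphism from the spectrum of the complex field to \<open>X\<close> is a point \<open>x\<close> together with a local
  homomorphism from the stalk at \<open>x\<close> to the complex numbers.
\<close>

type_synonym ('p, 'r) cpoint = "'p \<times> (('p set \<times> 'r) set \<Rightarrow> complex)"

definition cpoints :: "('p, 'r) rspace \<Rightarrow> ('p, 'r) cpoint set" where
  "cpoints X = {(x, \<phi>). x \<in> topspace (rtop X) \<and>
     \<phi> \<in> ring_hom (stalk X x) type_ring \<inter> extensional (carrier (stalk X x)) \<and>
     (\<forall>a\<in>carrier (stalk X x). \<phi> a \<noteq> 0 \<longrightarrow> a \<in> Units (stalk X x))}"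

definition cvalue :: "('p, 'r) rspace \<Rightarrow> 'p set \<Rightarrow> 'r \<Rightarrow> ('p, 'r) cpoint \<Rightarrow> complex" where
  "cvalue X U f P = snd P (rgerm X (fst P) U f)"

definition conj_point :: "('p, 'r) rspace \<Rightarrow> ('p, 'r) cpoint \<Rightarrow> ('p, 'r) cpoint" where
  "conj_point X P = (fst P, restrict (\<lambda>a. cnj (snd P a)) (carrier (stalk X (fst P))))"

definition ctop :: "('p, 'r) rspace \<Rightarrow> ('p, 'r) cpoint topology" where
  "ctop X = topology_generated_by
     {{P \<in> cpoints X. fst P \<in> U \<and> cvalue X U f P \<in> D} |U f D.
        openin (rtop X) U \<and> f \<in> carrier (rsec X U) \<and> open D}"

text \<open>
  Infinite differentiability of functions of finitely many complex variables, in the real sense: all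
  iterated directional derivatives exist and are continuous. Finitely many variables means that
  all but finitely many coordinates are held at 0.
\<close>

coinductive smooth_fun :: "(nat \<Rightarrow> complex) set \<Rightarrow> ((nat \<Rightarrow> complex) \<Rightarrow> real) \<Rightarrow> bool" for D where
  "continuous_on D F \<Longrightarrow>
   (\<forall>j v. \<exists>G. smooth_fun D G \<and>
      (\<forall>z\<in>D. ((\<lambda>t. F (z(j := z j + complex_of_real t * v))) has_real_derivative G z) (at 0))) \<Longrightarrow>
   smooth_fun D F"

text \<open>
  A function on an open set \<open>W\<close> of complex points, possibly singular, is smooth if it is locally the
  restriction of a smooth function on an ambient affine space.
\<close>

definition smooth_on_cpoints ::
  "('p, 'r) rspace \<Rightarrow> ('p, 'r) cpoint set \<Rightarrow> (('p, 'r) cpoint \<Rightarrow> real) \<Rightarrow> bool" where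
  "smooth_on_cpoints X W g \<longleftrightarrow>
     (\<forall>P\<in>W. \<exists>W' U fs D F. openin (ctop X) W' \<and> P \<in> W' \<and> W' \<subseteq> W \<and>
        openin (rtop X) U \<and> fst ` W' \<subseteq> U \<and> fs \<in> lists (carrier (rsec X U)) \<and>
        open D \<and> smooth_fun D F \<and>
        (\<forall>Q\<in>W'. let z = (\<lambda>j. if j < length fs then cvalue X U (fs ! j) Q else 0)
           in z \<in> D \<and> g Q = F z))"


section \<open>Metrized line sheaves\<close>

text \<open>
  The fibre at the complex point \<open>P = (x, \<phi>)\<close> of the pull-back of a line sheaf is the base change of its
  stalk at \<open>x\<close> along \<open>\<phi>\<close>, a complex line. A norm on this line is given by its values \<open>lnorm L P s\<close> on
  the images of the germs \<open>s\<close>.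
\<close>

record ('p, 'r, 's) mlsheaf =
  lsec :: "'p set \<Rightarrow> ('r, 's) module"
  lres :: "'p set \<Rightarrow> 'p set \<Rightarrow> 's \<Rightarrow> 's"
  lnorm :: "('p, 'r) cpoint \<Rightarrow> ('p set \<times> 's) set \<Rightarrow> real"

definition line_sheaf :: "('p, 'r) rspace \<Rightarrow> ('p, 'r, 's) mlsheaf \<Rightarrow> bool" where
  "line_sheaf X L \<longleftrightarrow>
     (\<forall>U. openin (rtop X) U \<longrightarrow> Module.module (rsec X U) (lsec L U)) \<and>
     is_sheaf (rtop X) (\<lambda>U. carrier (lsec L U)) (lres L) \<and>
     (\<forall>U V. openin (rtop X) U \<longrightarrow> openin (rtop X) V \<longrightarrow> V \<subseteq> U \<longrightarrow>
        (\<forall>s\<in>carrier (lsec L U).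
           (\<forall>t\<in>carrier (lsec L U).
              lres L U V (s \<oplus>\<^bsub>lsec L U\<^esub> t) = lres L U V s \<oplus>\<^bsub>lsec L V\<^esub> lres L U V t) \<and>
           (\<forall>f\<in>carrier (rsec X U).
              lres L U V (f \<odot>\<^bsub>lsec L U\<^esub> s) = rres X U V f \<odot>\<^bsub>lsec L V\<^esub> lres L U V s))) \<and>
     (\<forall>x\<in>topspace (rtop X). \<exists>U e. openin (rtop X) U \<and> x \<in> U \<and> e \<in> carrier (lsec L U) \<and>
        (\<forall>V. openin (rtop X) V \<longrightarrow> V \<subseteq> U \<longrightarrow>
           bij_betw (\<lambda>f. f \<odot>\<^bsub>lsec L V\<^esub> lres L U V e) (carrier (rsec X V)) (carrier (lsec L V))))"

definition lgerm ::
  "('p, 'r) rspace \<Rightarrow> ('p, 'r, 's) mlsheaf \<Rightarrow> 'p \<Rightarrow> 'p set \<Rightarrow> 's \<Rightarrow> ('p set \<times> 's) set" where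
  "lgerm X L = germ (rtop X) (\<lambda>U. carrier (lsec L U)) (lres L)"

definition lstalk ::
  "('p, 'r) rspace \<Rightarrow> ('p, 'r, 's) mlsheaf \<Rightarrow> 'p \<Rightarrow>
   (('p set \<times> 'r) set, ('p set \<times> 's) set) module" where
  "lstalk X L x =
     \<lparr>carrier = germs (rtop X) (\<lambda>U. carrier (lsec L U)) (lres L) x,
      mult = undefined,
      one = undefined,
      zero = lgerm X L x (topspace (rtop X)) \<zero>\<^bsub>lsec L (topspace (rtop X))\<^esub>,
      add = (\<lambda>a b. \<Union>(U, s)\<in>a. \<Union>(V, t)\<in>b. lgerm X L x (U \<inter> V)
        (lres L U (U \<inter> V) s \<oplus>\<^bsub>lsec L (U \<inter> V)\<^esub> lres L V (U \<inter> V) t)),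
      smult = (\<lambda>a b. \<Union>(U, f)\<in>a. \<Union>(V, t)\<in>b. lgerm X L x (U \<inter> V)
        (rres X U (U \<inter> V) f \<odot>\<^bsub>lsec L (U \<inter> V)\<^esub> lres L V (U \<inter> V) t))\<rparr>"

definition smoothly_metrized_line_sheaf :: "('p, 'r) rspace \<Rightarrow> ('p, 'r, 's) mlsheaf \<Rightarrow> bool" where
  "smoothly_metrized_line_sheaf X L \<longleftrightarrow> line_sheaf X L \<and>
     (\<forall>P\<in>cpoints X. \<forall>s\<in>carrier (lstalk X L (fst P)).
        0 \<le> lnorm L P s \<and>
        (\<forall>a\<in>carrier (stalk X (fst P)).
           lnorm L P (a \<odot>\<^bsub>lstalk X L (fst P)\<^esub> s) = cmod (snd P a) * lnorm L P s) \<and>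
        ((\<forall>t\<in>carrier (lstalk X L (fst P)). \<exists>a\<in>carrier (stalk X (fst P)).
            t = a \<odot>\<^bsub>lstalk X L (fst P)\<^esub> s) \<longrightarrow> 0 < lnorm L P s) \<and>
        lnorm L (conj_point X P) s = lnorm L P s) \<and>
     (\<forall>U s. openin (rtop X) U \<longrightarrow> s \<in> carrier (lsec L U) \<longrightarrow>
        smooth_on_cpoints X {P \<in> cpoints X. fst P \<in> U}
          (\<lambda>P. (lnorm L P (lgerm X L (fst P) U s))\<^sup>2))"

text \<open>Small sections; the supremum is formed in the extended nonnegative reals.\<close>

definition small_sections :: "('p, 'r) rspace \<Rightarrow> ('p, 'r, 's) mlsheaf \<Rightarrow> 's set" where
  "small_sections X L = {s \<in> carrier (lsec L (topspace (rtop X))).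
     (SUP P\<in>cpoints X. ennreal (lnorm L P (lgerm X L (fst P) (topspace (rtop X)) s))) \<le> 1}"

definition h0 :: "('p, 'r) rspace \<Rightarrow> ('p, 'r, 's) mlsheaf \<Rightarrow> real" where
  "h0 X L = ln (real (card (small_sections X L)))"

text \<open>
  \<open>twist a L\<close> is the tensor product of \<open>L\<close> with the structure sheaf metrized so that the section 1
  has constant norm \<open>exp (- a)\<close>.
\<close>

definition twist :: "real \<Rightarrow> ('p, 'r, 's) mlsheaf \<Rightarrow> ('p, 'r, 's) mlsheaf" where
  "twist a L = L\<lparr>lnorm := (\<lambda>P s. exp (- a) * lnorm L P s)\<rparr>"


section \<open>Tensor powers\<close>

text \<open>
  A list of pairs \<open>(c, [s\<^sub>1, \<dots>, s\<^sub>n])\<close> is a formal finite sum of tensors \<open>c \<cdot> s\<^sub>1 \<otimes> \<dots> \<otimes> s\<^sub>n\<close>; such sums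
  modulo \<open>tensor_eq R M n\<close> form the \<open>n\<close>-th tensor power of the \<open>R\<close>-module \<open>M\<close>.
\<close>

definition texps :: "'a ring \<Rightarrow> ('a, 'm) module \<Rightarrow> nat \<Rightarrow> ('a \<times> 'm list) list set" where
  "texps R M n = lists (carrier R \<times> {l \<in> lists (carrier M). length l = n})"

inductive tensor_eq ::
  "'a ring \<Rightarrow> ('a, 'm) module \<Rightarrow> nat \<Rightarrow> ('a \<times> 'm list) list \<Rightarrow> ('a \<times> 'm list) list \<Rightarrow> bool"
  for R M n where
  refl: "E \<in> texps R M n \<Longrightarrow> tensor_eq R M n E E"
| sym: "tensor_eq R M n E F \<Longrightarrow> tensor_eq R M n F E"
| trans: "tensor_eq R M n E F \<Longrightarrow> tensor_eq R M n F G \<Longrightarrow> tensor_eq R M n E G"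
| cong: "tensor_eq R M n E E' \<Longrightarrow> tensor_eq R M n F F' \<Longrightarrow> tensor_eq R M n (E @ F) (E' @ F')"
| comm: "E \<in> texps R M n \<Longrightarrow> F \<in> texps R M n \<Longrightarrow> tensor_eq R M n (E @ F) (F @ E)"
| zero: "[(\<zero>\<^bsub>R\<^esub>, l)] \<in> texps R M n \<Longrightarrow> tensor_eq R M n [(\<zero>\<^bsub>R\<^esub>, l)] []"
| add_coeff: "[(c, l), (d, l)] \<in> texps R M n \<Longrightarrow>
    tensor_eq R M n [(c \<oplus>\<^bsub>R\<^esub> d, l)] [(c, l), (d, l)]"
| add_factor: "[(c, k @ [x] @ l), (c, k @ [y] @ l)] \<in> texps R M n \<Longrightarrow>
    tensor_eq R M n [(c, k @ [x \<oplus>\<^bsub>M\<^esub> y] @ l)] [(c, k @ [x] @ l), (c, k @ [y] @ l)]"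
| smult_factor: "[(c, k @ [x] @ l)] \<in> texps R M n \<Longrightarrow> r \<in> carrier R \<Longrightarrow>
    tensor_eq R M n [(c, k @ [r \<odot>\<^bsub>M\<^esub> x] @ l)] [(c \<otimes>\<^bsub>R\<^esub> r, k @ [x] @ l)]"

definition tclass ::
  "'a ring \<Rightarrow> ('a, 'm) module \<Rightarrow> nat \<Rightarrow> ('a \<times> 'm list) list \<Rightarrow> ('a \<times> 'm list) list set" where
  "tclass R M n E = {F. tensor_eq R M n E F}"

definition tadd ::
  "'a ring \<Rightarrow> ('a, 'm) module \<Rightarrow> nat \<Rightarrow> ('a \<times> 'm list) list set \<Rightarrow> ('a \<times> 'm list) list set \<Rightarrow>
   ('a \<times> 'm list) list set" where
  "tadd R M n A B = (\<Union>E\<in>A. \<Union>F\<in>B. tclass R M n (E @ F))"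

definition tsmult ::
  "'a ring \<Rightarrow> ('a, 'm) module \<Rightarrow> nat \<Rightarrow> 'a \<Rightarrow> ('a \<times> 'm list) list set \<Rightarrow>
   ('a \<times> 'm list) list set" where
  "tsmult R M n c A = (\<Union>E\<in>A. tclass R M n (map (\<lambda>(d, l). (c \<otimes>\<^bsub>R\<^esub> d, l)) E))"

definition tmult ::
  "'a ring \<Rightarrow> ('a, 'm) module \<Rightarrow> nat \<Rightarrow> nat \<Rightarrow> ('a \<times> 'm list) list set \<Rightarrow>
   ('a \<times> 'm list) list set \<Rightarrow> ('a \<times> 'm list) list set" where
  "tmult R M m n A B =
     (\<Union>E\<in>A. \<Union>F\<in>B. tclass R M (m + n)
        (concat (map (\<lambda>(c, k). map (\<lambda>(d, l). (c \<otimes>\<^bsub>R\<^esub> d, k @ l)) F) E)))"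

type_synonym ('p, 'r, 's) tpow_section =
  "'p \<Rightarrow> (('p set \<times> 'r) set \<times> ('p set \<times> 's) set list) list set"

text \<open>
  Sections of the tensor power sheaf: families of elements of the tensor powers of the stalks that
  are locally induced by formal sums of tensors of sections. Its metric is the one for which the
  norm of a tensor of sections is the product of the norms of its factors.
\<close>

definition tpow ::
  "('p, 'r) rspace \<Rightarrow> ('p, 'r, 's) mlsheaf \<Rightarrow> nat \<Rightarrow>
   ('p, 'r, ('p, 'r, 's) tpow_section) mlsheaf" where
  "tpow X L n =
     \<lparr>lsec = (\<lambda>U.
        \<lparr>carrier = {s \<in> extensional U. \<forall>x\<in>U. \<exists>V E. openin (rtop X) V \<and> x \<in> V \<and> V \<subseteq> U \<and>
           E \<in> texps (rsec X V) (lsec L V) n \<and>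
           (\<forall>y\<in>V. s y = tclass (stalk X y) (lstalk X L y) n
              (map (\<lambda>(c, l). (rgerm X y V c, map (lgerm X L y V) l)) E))},
         mult = undefined,
         one = undefined,
         zero = (\<lambda>x\<in>U. tclass (stalk X x) (lstalk X L x) n []),
         add = (\<lambda>s t. \<lambda>x\<in>U. tadd (stalk X x) (lstalk X L x) n (s x) (t x)),
         smult = (\<lambda>f s. \<lambda>x\<in>U. tsmult (stalk X x) (lstalk X L x) n (rgerm X x U f) (s x))\<rparr>),
      lres = (\<lambda>U V s. restrict s V),
      lnorm = (\<lambda>P g. THE r. \<exists>(V, s)\<in>g. \<exists>c l. [(c, l)] \<in> s (fst P) \<and>
        r = cmod (snd P c) * prod_list (map (lnorm L P) l))\<rparr>"

definition tprod ::
  "('p, 'r) rspace \<Rightarrow> ('p, 'r, 's) mlsheaf \<Rightarrow> nat \<Rightarrow> nat \<Rightarrow> ('p, 'r, 's) tpow_section \<Rightarrow>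
   ('p, 'r, 's) tpow_section \<Rightarrow> ('p, 'r, 's) tpow_section" where
  "tprod X L m n s t =
     (\<lambda>x\<in>topspace (rtop X). tmult (stalk X x) (lstalk X L x) m n (s x) (t x))"

text \<open>
  The dual line sheaf, a sheaf of homomorphisms, with the dual metric. A section over \<open>U\<close> is a family
  of linear maps, one for each open subset of \<open>U\<close>, that is compatible with restriction.
\<close>

definition dual :: "('p, 'r) rspace \<Rightarrow> ('p, 'r, 's) mlsheaf \<Rightarrow> ('p, 'r, 'p set \<Rightarrow> 's \<Rightarrow> 'r) mlsheaf" where
  "dual X L =
     \<lparr>lsec = (\<lambda>U.
        \<lparr>carrier = {\<psi> \<in> extensional {V. openin (rtop X) V \<and> V \<subseteq> U}.
           \<forall>V. openin (rtop X) V \<longrightarrow> V \<subseteq> U \<longrightarrow>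
             \<psi> V \<in> carrier (lsec L V) \<rightarrow>\<^sub>E carrier (rsec X V) \<and>
             (\<forall>s\<in>carrier (lsec L V).
                (\<forall>t\<in>carrier (lsec L V). \<psi> V (s \<oplus>\<^bsub>lsec L V\<^esub> t) = \<psi> V s \<oplus>\<^bsub>rsec X V\<^esub> \<psi> V t) \<and>
                (\<forall>f\<in>carrier (rsec X V). \<psi> V (f \<odot>\<^bsub>lsec L V\<^esub> s) = f \<otimes>\<^bsub>rsec X V\<^esub> \<psi> V s) \<and>
                (\<forall>W. openin (rtop X) W \<longrightarrow> W \<subseteq> V \<longrightarrow> \<psi> W (lres L V W s) = rres X V W (\<psi> V s)))},
         mult = undefined,
         one = undefined,
         zero = (\<lambda>V\<in>{V. openin (rtop X) V \<and> V \<subseteq> U}. \<lambda>s\<in>carrier (lsec L V). \<zero>\<^bsub>rsec X V\<^esub>),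
         add = (\<lambda>\<psi> \<psi>'. \<lambda>V\<in>{V. openin (rtop X) V \<and> V \<subseteq> U}. \<lambda>s\<in>carrier (lsec L V).
           \<psi> V s \<oplus>\<^bsub>rsec X V\<^esub> \<psi>' V s),
         smult = (\<lambda>f \<psi>. \<lambda>V\<in>{V. openin (rtop X) V \<and> V \<subseteq> U}. \<lambda>s\<in>carrier (lsec L V).
           rres X U V f \<otimes>\<^bsub>rsec X V\<^esub> \<psi> V s)\<rparr>),
      lres = (\<lambda>U U' \<psi>. restrict \<psi> {V. openin (rtop X) V \<and> V \<subseteq> U'}),
      lnorm = (\<lambda>P g. THE r. \<exists>(U, \<psi>)\<in>g. \<exists>V e. openin (rtop X) V \<and> fst P \<in> V \<and> V \<subseteq> U \<and>
        e \<in> carrier (lsec L V) \<and> lnorm L P (lgerm X L (fst P) V e) \<noteq> 0 \<and>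
        r = cmod (cvalue X V (\<psi> V e) P) / lnorm L P (lgerm X L (fst P) V e))\<rparr>"

definition h0_pow :: "('p, 'r) rspace \<Rightarrow> ('p, 'r, 's) mlsheaf \<Rightarrow> int \<Rightarrow> real" where
  "h0_pow X L m =
     (if 0 \<le> m then h0 X (tpow X L (nat m)) else h0 X (tpow X (dual X L) (nat (- m))))"

end

theory Submission
  imports Defs
begin

text \<open>
  This is Siegel's lemma. Write \<open>S\<^sub>n\<close> for the small sections of the \<open>n\<close>-th tensor power; the lower bound
  on \<open>h0\<close> makes it finite for \<open>n = b\<close> and \<open>n = h + b\<close>. As the entries of \<open>A\<close> have norm at most \<open>1 / N\<close>, the map
  \<open>v \<mapsto> A v\<close> sends vectors over \<open>S\<^sub>b\<close> to vectors over \<open>S\<^bsub>h + b\<^esub>\<close>. The numerical hypothesis says that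
  \<open>M c\<^sub>1\<^sub>2 (h + b)\<^bsup>d + 1\<^esup> < N c\<^sub>1\<^sub>1 b\<^bsup>d + 1\<^esup>\<close>, so the source has more elements than the target, and the difference
  of two vectors with the same image is a nonzero vector in the kernel with entries of norm at most 2.
\<close>

text \<open>The count itself is short; the work lies in showing that \<open>v \<mapsto> A v\<close>
  is additive and bounding its norm. Operations on germs and on tensor classes are unions over all
  representatives, and norms of tensor sections are definite descriptions, so each has to be shown
  independent of choices. The device is to work at one point at a time: the stalk of a line sheaf is
  free of rank one, hence so is each tensor power, and a class amounts to a single ring element, its
  coordinate. Sums, products and negatives of sections become those of coordinates. Evaluating the
  coordinate at a complex point gives a complex number, so additivity becomes ring arithmetic and
  the norm bound the triangle inequality in the complex numbers. The generators at different points
  need not be related, because being a section is checked on formal sums over open sets and not on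
  coordinates.\<close>

lemma UN_UN_constant:
  assumes "a \<in> A" "b \<in> B" "\<And>a b. a \<in> A \<Longrightarrow> b \<in> B \<Longrightarrow> f a b = c"
  shows "(\<Union>a\<in>A. \<Union>b\<in>B. f a b) = c"
  using assms by auto

section \<open>Germs\<close>

lemma is_sheaf_closed:
  assumes "is_sheaf T F res" "openin T U" "openin T V" "V \<subseteq> U" "s \<in> F U"
  shows "res U V s \<in> F V"
  using assms(1)[unfolded is_sheaf_def, THEN conjunct1] assms(2-) by blast

lemma is_sheaf_res_res:
  assumes "is_sheaf T F res" "openin T U" "openin T V" "openin T W" "W \<subseteq> V" "V \<subseteq> U" "s \<in> F U"
  shows "res V W (res U V s) = res U W s"
  using assms(1)[unfolded is_sheaf_def, THEN conjunct2, THEN conjunct2, THEN conjunct1] assms(2-)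
  by blast

text \<open>A germ is the full equivalence class of its representatives. The substance is
  transitivity: agreement on \<open>W\<close> and agreement on \<open>Z\<close> combine to agreement
  on \<open>W \<inter> Z\<close>.\<close>

lemma germ_eq_iff:
  assumes sh: "is_sheaf T F res"
    and U: "openin T U" "x \<in> U" "s \<in> F U" and V: "openin T V" "x \<in> V" "t \<in> F V"
  shows "germ T F res x U s = germ T F res x V t \<longleftrightarrow>
    (\<exists>W. openin T W \<and> x \<in> W \<and> W \<subseteq> U \<inter> V \<and> res U W s = res V W t)"
proof
  assume eq: "germ T F res x U s = germ T F res x V t"
  have "(V, t) \<in> germ T F res x V t"
    unfolding germ_def using V by auto
  then have "(V, t) \<in> germ T F res x U s"
    by (simp add: eq)
  then show "\<exists>W. openin T W \<and> x \<in> W \<and> W \<subseteq> U \<inter> V \<and> res U W s = res V W t"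
    unfolding germ_def by blast
next
  have *: "germ T F res x U s \<subseteq> germ T F res x V t"
    if U: "openin T U" "x \<in> U" "s \<in> F U" and V: "openin T V" "x \<in> V" "t \<in> F V"
      and W: "openin T W" "x \<in> W" "W \<subseteq> U \<inter> V" "res U W s = res V W t" for U V W s t
  proof (clarify)
    fix Y r assume "(Y, r) \<in> germ T F res x U s"
    then obtain Z where Y: "openin T Y" "x \<in> Y" "r \<in> F Y"
      and Z: "openin T Z" "x \<in> Z" "Z \<subseteq> U \<inter> Y" "res U Z s = res Y Z r"
      unfolding germ_def by blast
    have op: "openin T (W \<inter> Z)" using W Z by blast
    have "res V (W \<inter> Z) t = res W (W \<inter> Z) (res V W t)"
      using is_sheaf_res_res[OF sh] V W op by auto
    also have "\<dots> = res U (W \<inter> Z) s"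
      using is_sheaf_res_res[OF sh U(1) W(1) op _ _ U(3)] W(3,4) by simp
    also have "\<dots> = res Z (W \<inter> Z) (res Y Z r)"
      using is_sheaf_res_res[OF sh U(1) Z(1) op _ _ U(3)] Z(3,4) by simp
    also have "\<dots> = res Y (W \<inter> Z) r"
      using is_sheaf_res_res[OF sh Y(1) Z(1) op] Y Z by auto
    finally have "res V (W \<inter> Z) t = res Y (W \<inter> Z) r" .
    then show "(Y, r) \<in> germ T F res x V t"
      unfolding germ_def using Y Z W op by blast
  qed
  assume "\<exists>W. openin T W \<and> x \<in> W \<and> W \<subseteq> U \<inter> V \<and> res U W s = res V W t"
  then obtain W where W: "openin T W" "x \<in> W" "W \<subseteq> U \<inter> V" "res U W s = res V W t"
    by blast
  show "germ T F res x U s = germ T F res x V t"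
    using *[OF U V W] *[OF V U, of W] W by auto
qed

lemma germ_res:
  assumes sh: "is_sheaf T F res" and "openin T U" "openin T V" "V \<subseteq> U" "x \<in> V" "s \<in> F U"
  shows "germ T F res x V (res U V s) = germ T F res x U s"
proof (subst germ_eq_iff[OF sh])
  show "\<exists>W. openin T W \<and> x \<in> W \<and> W \<subseteq> V \<inter> U \<and> res V W (res U V s) = res U W s"
    using assms is_sheaf_res_res[OF sh, of U V V] by (intro exI[of _ V]) auto
qed (use assms is_sheaf_closed[OF sh, of U V s] in auto)

lemma germ_self:
  assumes "openin T U" "x \<in> U" "s \<in> F U"
  shows "(U, s) \<in> germ T F res x U s"
  unfolding germ_def using assms by auto

text \<open>Allows a germ to be represented inside a prescribed neighbourhood, such as one on which
  a line sheaf is trivial.\<close>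

lemma germs_rep_inside:
  assumes sh: "is_sheaf T F res" and "a \<in> germs T F res x" and U: "openin T U" "x \<in> U"
  obtains V s where "openin T V" "x \<in> V" "V \<subseteq> U" "s \<in> F V" "a = germ T F res x V s"
proof -
  obtain V s where V: "openin T V" "x \<in> V" "s \<in> F V" "a = germ T F res x V s"
    using assms(2) unfolding germs_def by blast
  have op: "openin T (U \<inter> V)" using U V by blast
  show ?thesis
    using that[of "U \<inter> V" "res V (U \<inter> V) s"] V U op germ_res[OF sh V(1) op, of x s]
      is_sheaf_closed[OF sh V(1) op] by auto
qed

text \<open>The operations on germs in the definitions of stalks are all of the form on the left.\<close>

lemma germ_binary_op:
  assumes F: "is_sheaf T F resF" and G: "is_sheaf T G resG" and H: "is_sheaf T H resH"
    and closed: "\<And>U s t. openin T U \<Longrightarrow> s \<in> F U \<Longrightarrow> t \<in> G U \<Longrightarrow> f U s t \<in> H U"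
    and compat: "\<And>U V s t. openin T U \<Longrightarrow> openin T V \<Longrightarrow> V \<subseteq> U \<Longrightarrow> s \<in> F U \<Longrightarrow> t \<in> G U \<Longrightarrow>
      resH U V (f U s t) = f V (resF U V s) (resG U V t)"
    and U: "openin T U" "x \<in> U" "s \<in> F U" "t \<in> G U"
  shows "(\<Union>(V, s')\<in>germ T F resF x U s. \<Union>(W, t')\<in>germ T G resG x U t.
      germ T H resH x (V \<inter> W) (f (V \<inter> W) (resF V (V \<inter> W) s') (resG W (V \<inter> W) t'))) =
    germ T H resH x U (f U s t)"
proof -
  have const: "germ T H resH x (V \<inter> W) (f (V \<inter> W) (resF V (V \<inter> W) s') (resG W (V \<inter> W) t')) =
      germ T H resH x U (f U s t)"
    if Vs: "(V, s') \<in> germ T F resF x U s" and Wt: "(W, t') \<in> germ T G resG x U t" for V W s' t'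
  proof -
    obtain Y where V: "openin T V" "x \<in> V" "s' \<in> F V"
      and Y: "openin T Y" "x \<in> Y" "Y \<subseteq> U \<inter> V" "resF U Y s = resF V Y s'"
      using Vs unfolding germ_def by blast
    obtain Z where W: "openin T W" "x \<in> W" "t' \<in> G W"
      and Z: "openin T Z" "x \<in> Z" "Z \<subseteq> U \<inter> W" "resG U Z t = resG W Z t'"
      using Wt unfolding germ_def by blast
    have YZ: "openin T (Y \<inter> Z)" and VW: "openin T (V \<inter> W)" using V W Y Z by blast+
    have s: "resF U (Y \<inter> Z) s = resF V (Y \<inter> Z) s'"
      using is_sheaf_res_res[OF F U(1) Y(1) YZ _ _ U(3)]
        is_sheaf_res_res[OF F V(1) Y(1) YZ _ _ V(3)] Y(3,4) by simp
    have t: "resG U (Y \<inter> Z) t = resG W (Y \<inter> Z) t'"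
      using is_sheaf_res_res[OF G U(1) Z(1) YZ _ _ U(4)]
        is_sheaf_res_res[OF G W(1) Z(1) YZ _ _ W(3)] Z(3,4) by simp
    have s': "resF V (V \<inter> W) s' \<in> F (V \<inter> W)" and t': "resG W (V \<inter> W) t' \<in> G (V \<inter> W)"
      using is_sheaf_closed[OF F V(1) VW] is_sheaf_closed[OF G W(1) VW] V W by auto
    have sub: "Y \<inter> Z \<subseteq> V \<inter> W" "Y \<inter> Z \<subseteq> U" using Y Z by auto
    \<comment> \<open>The first arguments agree on \<open>Y\<close> and the second ones on
      \<open>Z\<close>. On \<open>Y \<inter> Z\<close> both agree, and \<open>compat\<close> moves
      \<open>f\<close> past the restriction.\<close>
    have "resH (V \<inter> W) (Y \<inter> Z) (f (V \<inter> W) (resF V (V \<inter> W) s') (resG W (V \<inter> W) t')) =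
        f (Y \<inter> Z) (resF (V \<inter> W) (Y \<inter> Z) (resF V (V \<inter> W) s'))
          (resG (V \<inter> W) (Y \<inter> Z) (resG W (V \<inter> W) t'))"
      by (rule compat[OF VW YZ sub(1) s' t'])
    also have "\<dots> = f (Y \<inter> Z) (resF V (Y \<inter> Z) s') (resG W (Y \<inter> Z) t')"
      using is_sheaf_res_res[OF F V(1) VW YZ sub(1)] is_sheaf_res_res[OF G W(1) VW YZ sub(1)] V W
      by auto
    also have "\<dots> = resH U (Y \<inter> Z) (f U s t)"
      using compat[OF U(1) YZ sub(2) U(3,4)] s t by simp
    finally have eq: "resH (V \<inter> W) (Y \<inter> Z)
      (f (V \<inter> W) (resF V (V \<inter> W) s') (resG W (V \<inter> W) t')) = resH U (Y \<inter> Z) (f U s t)" .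
    show ?thesis
    proof (subst germ_eq_iff[OF H])
      show "\<exists>Q. openin T Q \<and> x \<in> Q \<and> Q \<subseteq> V \<inter> W \<inter> U \<and>
          resH (V \<inter> W) Q (f (V \<inter> W) (resF V (V \<inter> W) s') (resG W (V \<inter> W) t')) =
          resH U Q (f U s t)"
        using eq sub YZ Y Z by (intro exI[of _ "Y \<inter> Z"]) auto
    qed (use VW V W U closed[OF VW s' t'] closed[OF U(1,3,4)] in auto)
  qed
  have "(U, s) \<in> germ T F resF x U s" "(U, t) \<in> germ T G resG x U t"
    using U by (auto intro: germ_self)
  then show ?thesis
    unfolding case_prod_unfold by (rule UN_UN_constant) (use const in auto)
qed

section \<open>Tensor powers of a free module of rank one\<close>

text \<open>
  Closure and linearity are only required along the generator \<open>e\<close>, where they can be checked on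
  germs; they extend to all of \<open>M\<close> through the coordinate.
\<close>

locale free_rank_one = cring R for R :: "'a ring" (structure) and M :: "('a, 'm) module" and e +
  assumes gen_closed: "e \<in> carrier M"
    and smult_gen_closed: "r \<in> carrier R \<Longrightarrow> r \<odot>\<^bsub>M\<^esub> e \<in> carrier M"
    and coord_ex1: "x \<in> carrier M \<Longrightarrow> \<exists>!r. r \<in> carrier R \<and> x = r \<odot>\<^bsub>M\<^esub> e"
    and add_smult_gen: "r \<in> carrier R \<Longrightarrow> s \<in> carrier R \<Longrightarrow>
      (r \<oplus> s) \<odot>\<^bsub>M\<^esub> e = r \<odot>\<^bsub>M\<^esub> e \<oplus>\<^bsub>M\<^esub> s \<odot>\<^bsub>M\<^esub> e"
    and mult_smult_gen: "r \<in> carrier R \<Longrightarrow> s \<in> carrier R \<Longrightarrow>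
      (r \<otimes> s) \<odot>\<^bsub>M\<^esub> e = r \<odot>\<^bsub>M\<^esub> (s \<odot>\<^bsub>M\<^esub> e)"
begin

lemma replicate_gen_closed [simp]: "replicate i e \<in> lists (carrier M)"
  by (induction i) (auto simp: gen_closed)

definition coord :: "'m \<Rightarrow> 'a" where
  "coord x = (THE r. r \<in> carrier R \<and> x = r \<odot>\<^bsub>M\<^esub> e)"

lemma coord_closed [simp]: "x \<in> carrier M \<Longrightarrow> coord x \<in> carrier R"
  and coord_smult: "x \<in> carrier M \<Longrightarrow> coord x \<odot>\<^bsub>M\<^esub> e = x"
  using theI'[OF coord_ex1, of x] unfolding coord_def by auto

lemma coord_smult_gen [simp]: "r \<in> carrier R \<Longrightarrow> coord (r \<odot>\<^bsub>M\<^esub> e) = r"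
  unfolding coord_def by (rule the1_equality[OF coord_ex1[OF smult_gen_closed]]) auto

lemma
  assumes "x \<in> carrier M" "y \<in> carrier M"
  shows add_closed_M: "x \<oplus>\<^bsub>M\<^esub> y \<in> carrier M"
    and coord_add: "coord (x \<oplus>\<^bsub>M\<^esub> y) = coord x \<oplus> coord y"
proof -
  have eq: "x \<oplus>\<^bsub>M\<^esub> y = (coord x \<oplus> coord y) \<odot>\<^bsub>M\<^esub> e"
    using assms by (simp add: add_smult_gen coord_smult)
  show "x \<oplus>\<^bsub>M\<^esub> y \<in> carrier M" "coord (x \<oplus>\<^bsub>M\<^esub> y) = coord x \<oplus> coord y"
    unfolding eq using assms by (simp_all add: smult_gen_closed)
qed

lemma
  assumes "r \<in> carrier R" "x \<in> carrier M"
  shows smult_closed_M: "r \<odot>\<^bsub>M\<^esub> x \<in> carrier M"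
    and coord_smult_eq: "coord (r \<odot>\<^bsub>M\<^esub> x) = r \<otimes> coord x"
proof -
  have eq: "r \<odot>\<^bsub>M\<^esub> x = (r \<otimes> coord x) \<odot>\<^bsub>M\<^esub> e"
    using assms by (simp add: mult_smult_gen coord_smult)
  show "r \<odot>\<^bsub>M\<^esub> x \<in> carrier M" "coord (r \<odot>\<^bsub>M\<^esub> x) = r \<otimes> coord x"
    unfolding eq using assms by (simp_all add: smult_gen_closed)
qed

definition coords :: "'m list \<Rightarrow> 'a" where
  "coords l = foldr (\<lambda>x y. coord x \<otimes> y) l \<one>"

lemma coords_simps [simp]:
  "coords [] = \<one>" "coords (x # l) = coord x \<otimes> coords l"
  by (simp_all add: coords_def)

lemma coords_closed [simp]: "l \<in> lists (carrier M) \<Longrightarrow> coords l \<in> carrier R"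
  by (induction l) auto

lemma coords_append [simp]:
  "k \<in> lists (carrier M) \<Longrightarrow> l \<in> lists (carrier M) \<Longrightarrow> coords (k @ l) = coords k \<otimes> coords l"
  by (induction k) (auto simp: m_assoc simp flip: in_lists_conv_set)

text \<open>The isomorphism from the tensor power onto \<open>R\<close> that sends the power of
  \<open>e\<close> to \<open>\<one>\<close>, computed on formal sums. The same formula serves all
  exponents \<open>n\<close>.\<close>

definition teval :: "('a \<times> 'm list) list \<Rightarrow> 'a" where
  "teval E = foldr (\<lambda>(c, l) y. c \<otimes> coords l \<oplus> y) E \<zero>"

lemma teval_simps [simp]:
  "teval [] = \<zero>" "teval ((c, l) # E) = c \<otimes> coords l \<oplus> teval E"
  by (simp_all add: teval_def)

end

lemma texps_Nil [simp]: "[] \<in> texps R M n"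
  by (simp add: texps_def)

lemma texps_Cons [simp]:
  "(c, l) # E \<in> texps R M n \<longleftrightarrow>
     c \<in> carrier R \<and> l \<in> lists (carrier M) \<and> length l = n \<and> E \<in> texps R M n"
  by (auto simp: texps_def)

lemma texps_append [simp]:
  "E @ F \<in> texps R M n \<longleftrightarrow> E \<in> texps R M n \<and> F \<in> texps R M n"
  by (auto simp: texps_def)

context free_rank_one
begin

lemma teval_closed [simp]: "E \<in> texps R M n \<Longrightarrow> teval E \<in> carrier R"
  by (induction E) auto

lemma teval_append [simp]:
  "E \<in> texps R M n \<Longrightarrow> F \<in> texps R M n \<Longrightarrow> teval (E @ F) = teval E \<oplus> teval F"
  by (induction E) (auto simp: a_assoc simp flip: in_lists_conv_set)

text \<open>Each generating relation preserves \<open>teval\<close>; the one that moves a scalar out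
  of a factor uses commutativity of \<open>R\<close>. Membership in \<open>texps\<close> is carried
  along because the induction needs closure to split \<open>teval\<close> over
  \<open>@\<close>.\<close>

lemma tensor_eq_imp_teval:
  assumes "tensor_eq R M n E F"
  shows "E \<in> texps R M n \<and> F \<in> texps R M n \<and> teval E = teval F"
  using assms
proof induction
  case (comm E F)
  then show ?case by (auto intro: a_comm teval_closed)
next
  case (add_coeff c l d)
  then show ?case by (auto simp: l_distr simp flip: in_lists_conv_set)
next
  case (add_factor c k x l y)
  then have "k \<in> lists (carrier M)" "l \<in> lists (carrier M)" by auto
  then show ?case
    using add_factor by (auto simp: add_closed_M coord_add r_distr l_distr)
next
  case (smult_factor c k x l r)
  then have "k \<in> lists (carrier M)" "l \<in> lists (carrier M)" by auto
  then show ?case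
    using smult_factor by (auto simp: smult_closed_M coord_smult_eq m_ac)
qed auto

text \<open>Each factor \<open>x\<close> is written as \<open>coord x\<close> times \<open>e\<close>
  and the scalar is moved into the coefficient, from left to right. The prefix of \<open>i\<close>
  copies of \<open>e\<close> holds the factors already treated and makes the induction on
  \<open>l\<close> go through.\<close>

lemma tensor_eq_normal_single:
  assumes "c \<in> carrier R" "l \<in> lists (carrier M)"
  shows "tensor_eq R M (i + length l) [(c, replicate i e @ l)]
    [(c \<otimes> coords l, replicate (i + length l) e)]"
  using assms
proof (induction l arbitrary: c i)
  case Nil
  then show ?case by (auto intro!: tensor_eq.refl simp: gen_closed)
next
  case (Cons x l)
  then have x: "x \<in> carrier M" and l: "l \<in> lists (carrier M)" by auto
  have 1: "tensor_eq R M (i + length (x # l)) [(c, replicate i e @ x # l)]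
     [(c \<otimes> coord x, replicate i e @ [e] @ l)]"
    using tensor_eq.smult_factor[of c "replicate i e" e l R M "i + length (x # l)" "coord x"] Cons.prems
    by (simp add: gen_closed coord_smult)
  have 2: "tensor_eq R M (i + length (x # l)) [(c \<otimes> coord x, replicate i e @ [e] @ l)]
     [(c \<otimes> coord x \<otimes> coords l, replicate (i + length (x # l)) e)]"
    using Cons.IH[of "c \<otimes> coord x" "Suc i"] Cons.prems(1) x l
    by (simp add: replicate_app_Cons_same)
  have 3: "c \<otimes> coord x \<otimes> coords l = c \<otimes> coords (x # l)"
    using x l Cons.prems by (simp add: m_assoc)
  show ?case
    using tensor_eq.trans[OF 1 2] unfolding 3 .
qed

text \<open>Once all tensors are multiples of the same power of \<open>e\<close>,
  \<open>add_coeff\<close> read backwards merges them; the empty sum is covered by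
  \<open>zero\<close> read backwards.\<close>

lemma tensor_eq_normal:
  assumes "E \<in> texps R M n"
  shows "tensor_eq R M n E [(teval E, replicate n e)]"
  using assms
proof (induction E)
  case Nil
  show ?case
    by (auto intro!: tensor_eq.sym[OF tensor_eq.zero] simp: gen_closed)
next
  case (Cons p E)
  obtain c l where p: "p = (c, l)" by force
  have cl: "c \<in> carrier R" "l \<in> lists (carrier M)" "length l = n" "E \<in> texps R M n"
    using Cons.prems by (auto simp: p)
  have "tensor_eq R M n [(c, l)] [(c \<otimes> coords l, replicate n e)]"
    using tensor_eq_normal_single[of c l 0] cl by simp
  from tensor_eq.cong[OF this Cons.IH[OF cl(4)]]
  have "tensor_eq R M n (p # E) [(c \<otimes> coords l, replicate n e), (teval E, replicate n e)]"
    by (simp add: p)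
  moreover have "tensor_eq R M n [(c \<otimes> coords l \<oplus> teval E, replicate n e)]
      [(c \<otimes> coords l, replicate n e), (teval E, replicate n e)]"
    using cl by (intro tensor_eq.add_coeff) (auto simp: gen_closed simp flip: in_lists_conv_set)
  ultimately show ?case
    unfolding p teval_simps by (rule tensor_eq.trans[OF _ tensor_eq.sym])
qed

text \<open>
  The tensor power is again free of rank one, with \<open>teval\<close> as coordinate. This reduces all
  identities between classes of formal sums to identities in the ring.
\<close>

lemma tensor_eq_iff:
  "tensor_eq R M n E F \<longleftrightarrow> E \<in> texps R M n \<and> F \<in> texps R M n \<and> teval E = teval F"
proof
  assume "E \<in> texps R M n \<and> F \<in> texps R M n \<and> teval E = teval F"
  then show "tensor_eq R M n E F"
    using tensor_eq.trans[OF tensor_eq_normal[of E n]] tensor_eq.sym[OF tensor_eq_normal[of F n]]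
    by simp
qed (rule tensor_eq_imp_teval)

lemma tclass_eq: "E \<in> texps R M n \<Longrightarrow> tclass R M n E = {F \<in> texps R M n. teval F = teval E}"
  by (auto simp: tclass_def tensor_eq_iff)

lemma tclass_eq_iff:
  assumes "E \<in> texps R M n" "F \<in> texps R M n"
  shows "tclass R M n E = tclass R M n F \<longleftrightarrow> teval E = teval F"
proof
  assume "tclass R M n E = tclass R M n F"
  moreover have "E \<in> tclass R M n E"
    using assms by (simp add: tclass_eq)
  ultimately show "teval E = teval F"
    using assms by (simp add: tclass_eq)
qed (use assms in \<open>simp add: tclass_eq\<close>)

text \<open>The coordinate of \<open>E @ F\<close> depends only on those of \<open>E\<close> and
  \<open>F\<close>, so all members of the union defining \<open>tadd\<close> coincide.\<close>

lemma tadd_tclass: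
  assumes "E \<in> texps R M n" "F \<in> texps R M n"
  shows "tadd R M n (tclass R M n E) (tclass R M n F) = tclass R M n (E @ F)"
proof -
  have "tclass R M n (E' @ F') = tclass R M n (E @ F)"
    if "E' \<in> tclass R M n E" "F' \<in> tclass R M n F" for E' F'
    using that assms by (subst tclass_eq_iff) (auto simp: tclass_eq)
  moreover have "E \<in> tclass R M n E" "F \<in> tclass R M n F"
    using assms by (auto simp: tclass_eq)
  ultimately show ?thesis
    unfolding tadd_def by (intro UN_UN_constant)
qed

end

section \<open>Products and negatives of formal sums of tensors\<close>

definition tconcat ::
  "'a ring \<Rightarrow> ('a \<times> 'm list) list \<Rightarrow> ('a \<times> 'm list) list \<Rightarrow> ('a \<times> 'm list) list" where
  "tconcat R E F = concat (map (\<lambda>(c, k). map (\<lambda>(d, l). (c \<otimes>\<^bsub>R\<^esub> d, k @ l)) F) E)"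

text \<open>Represents the additive inverse. Negating coefficients rather than factors also works
  for \<open>n = 0\<close>, where there are no factors.\<close>

definition tneg :: "'a ring \<Rightarrow> ('a \<times> 'm list) list \<Rightarrow> ('a \<times> 'm list) list" where
  "tneg R E = map (\<lambda>(c, l). (\<ominus>\<^bsub>R\<^esub> c, l)) E"

lemma tconcat_simps [simp]:
  "tconcat R [] F = []"
  "tconcat R ((c, k) # E) F = map (\<lambda>(d, l). (c \<otimes>\<^bsub>R\<^esub> d, k @ l)) F @ tconcat R E F"
  by (simp_all add: tconcat_def)

lemma tneg_simps [simp]:
  "tneg R [] = []" "tneg R ((c, l) # E) = (\<ominus>\<^bsub>R\<^esub> c, l) # tneg R E"
  by (simp_all add: tneg_def)

lemma tconcat_single_closed:
  assumes "cring R" "c \<in> carrier R" "k \<in> lists (carrier M)" "length k = m" "F \<in> texps R M n"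
  shows "map (\<lambda>(d, l). (c \<otimes>\<^bsub>R\<^esub> d, k @ l)) F \<in> texps R M (m + n)"
  using assms(5)
proof (induction F)
  case (Cons p F)
  then show ?case
    using assms(1-4) by (cases p) (auto intro!: cring.cring_simprules(5))
qed simp

lemma tconcat_closed:
  assumes "cring R" "E \<in> texps R M m" "F \<in> texps R M n"
  shows "tconcat R E F \<in> texps R M (m + n)"
  using assms(2)
proof (induction E)
  case (Cons p E)
  then show ?case
    using assms tconcat_single_closed[OF assms(1) _ _ _ assms(3), of "fst p" "snd p"]
    by (cases p) auto
qed simp

lemma tneg_closed:
  assumes "cring R" "E \<in> texps R M n"
  shows "tneg R E \<in> texps R M n"
  using assms(2)
proof (induction E)
  case (Cons p E)
  then show ?case
    using assms(1) by (cases p) (auto intro!: cring.cring_simprules(3))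
qed simp

context free_rank_one
begin

lemma teval_tconcat_single:
  assumes "c \<in> carrier R" "k \<in> lists (carrier M)" "F \<in> texps R M n"
  shows "teval (map (\<lambda>(d, l). (c \<otimes> d, k @ l)) F) = c \<otimes> coords k \<otimes> teval F"
  using assms(3)
proof (induction F)
  case (Cons p F)
  obtain d l where p: "p = (d, l)" by force
  have "d \<in> carrier R" "l \<in> lists (carrier M)" "F \<in> texps R M n"
    using Cons.prems by (auto simp: p)
  with Cons.IH assms(1,2) show ?case
    by (simp add: p r_distr m_ac)
qed (use assms in simp)

text \<open>In coordinates tensor multiplication is multiplication in \<open>R\<close>, which is
  what later makes norms of sections multiplicative.\<close>

lemma teval_tconcat:
  assumes "E \<in> texps R M m" "F \<in> texps R M n"
  shows "teval (tconcat R E F) = teval E \<otimes> teval F"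
  using assms(1)
proof (induction E)
  case (Cons p E)
  obtain c k where p: "p = (c, k)" by force
  have c: "c \<in> carrier R" "k \<in> lists (carrier M)" "length k = m" "E \<in> texps R M m"
    using Cons.prems by (auto simp: p)
  have "teval (tconcat R (p # E) F) =
      teval (map (\<lambda>(d, l). (c \<otimes> d, k @ l)) F) \<oplus> teval (tconcat R E F)"
    unfolding p tconcat_simps
    by (rule teval_append[of _ "m + n"])
      (rule tconcat_single_closed[OF is_cring c(1-3) assms(2)] tconcat_closed[OF is_cring c(4) assms(2)])+
  then show ?case
    using c assms(2) Cons.IH by (simp add: p teval_tconcat_single l_distr)
qed (use assms in simp)

lemma teval_tneg:
  assumes "E \<in> texps R M n"
  shows "teval (tneg R E) = \<ominus> teval E"
  using assms
proof (induction E)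
  case (Cons p E)
  obtain c l where p: "p = (c, l)" by force
  have "c \<in> carrier R" "l \<in> lists (carrier M)" "E \<in> texps R M n"
    using Cons.prems by (auto simp: p)
  with Cons.IH show ?case
    by (simp add: p l_minus minus_add)
qed simp

lemma tmult_tclass:
  assumes "E \<in> texps R M m" "F \<in> texps R M n"
  shows "tmult R M m n (tclass R M m E) (tclass R M n F) = tclass R M (m + n) (tconcat R E F)"
proof -
  have "tclass R M (m + n) (tconcat R E' F') = tclass R M (m + n) (tconcat R E F)"
    if "E' \<in> tclass R M m E" "F' \<in> tclass R M n F" for E' F'
  proof -
    have "E' \<in> texps R M m" "teval E' = teval E" "F' \<in> texps R M n" "teval F' = teval F"
      using that assms by (simp_all add: tclass_eq)
    then show ?thesis
      using assms by (subst tclass_eq_iff) (auto simp: teval_tconcat tconcat_closed[OF is_cring])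
  qed
  moreover have "E \<in> tclass R M m E" "F \<in> tclass R M n F"
    using assms by (simp_all add: tclass_eq)
  ultimately show ?thesis
    unfolding tmult_def tconcat_def[symmetric] by (intro UN_UN_constant)
qed

end

section \<open>Stalks of a line sheaf\<close>

locale line_sheaf_on =
  fixes X :: "('p, 'r) rspace" and L :: "('p, 'r, 's) mlsheaf"
  assumes ringed_space: "ringed_space X" and line_sheaf: "line_sheaf X L"
begin

abbreviation "T \<equiv> rtop X"
abbreviation "OX \<equiv> rsec X"

lemma sec_cring: "openin T U \<Longrightarrow> cring (OX U)"
  using ringed_space unfolding ringed_space_def by blast

lemma res_hom: "openin T U \<Longrightarrow> openin T V \<Longrightarrow> V \<subseteq> U \<Longrightarrow> rres X U V \<in> ring_hom (OX U) (OX V)"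
  using ringed_space unfolding ringed_space_def by blast

lemma rsheaf: "is_sheaf T (\<lambda>U. carrier (OX U)) (rres X)"
  using ringed_space unfolding ringed_space_def by blast

lemmas line_sheafD =
  line_sheaf[unfolded line_sheaf_def, THEN conjunct1]
  line_sheaf[unfolded line_sheaf_def, THEN conjunct2, THEN conjunct1]
  line_sheaf[unfolded line_sheaf_def, THEN conjunct2, THEN conjunct2, THEN conjunct1]
  line_sheaf[unfolded line_sheaf_def, THEN conjunct2, THEN conjunct2, THEN conjunct2]

lemma lsheaf: "is_sheaf T (\<lambda>U. carrier (lsec L U)) (lres L)"
  by (rule line_sheafD(2))

lemma sec_module: "openin T U \<Longrightarrow> Module.module (OX U) (lsec L U)"
  using line_sheafD(1) by blast

lemma lres_add: "openin T U \<Longrightarrow> openin T V \<Longrightarrow> V \<subseteq> U \<Longrightarrow>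
    s \<in> carrier (lsec L U) \<Longrightarrow> t \<in> carrier (lsec L U) \<Longrightarrow>
    lres L U V (s \<oplus>\<^bsub>lsec L U\<^esub> t) = lres L U V s \<oplus>\<^bsub>lsec L V\<^esub> lres L U V t"
  using line_sheafD(3) by blast

lemma lres_smult: "openin T U \<Longrightarrow> openin T V \<Longrightarrow> V \<subseteq> U \<Longrightarrow>
    f \<in> carrier (OX U) \<Longrightarrow> s \<in> carrier (lsec L U) \<Longrightarrow>
    lres L U V (f \<odot>\<^bsub>lsec L U\<^esub> s) = rres X U V f \<odot>\<^bsub>lsec L V\<^esub> lres L U V s"
  using line_sheafD(3) by blast

section \<open>Operations on germs through common representatives\<close>

lemma sec_closed:
  assumes "openin T U" "s \<in> carrier (OX U)" "t \<in> carrier (OX U)"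
  shows "s \<otimes>\<^bsub>OX U\<^esub> t \<in> carrier (OX U)" "s \<oplus>\<^bsub>OX U\<^esub> t \<in> carrier (OX U)"
  using cring.cring_simprules(1,5)[OF sec_cring[OF assms(1)]] assms by auto

text \<open>The stalk operations are unions over pairs of representatives on unrelated open sets.
  This lemma and the next three replace them by operations over one common open set, so that
  identities in stalks can be read off from sections.\<close>

lemma rgerm_mult:
  assumes "openin T U" "x \<in> U" "s \<in> carrier (OX U)" "t \<in> carrier (OX U)"
  shows "rgerm X x U s \<otimes>\<^bsub>stalk X x\<^esub> rgerm X x U t = rgerm X x U (s \<otimes>\<^bsub>OX U\<^esub> t)"
  unfolding rgerm_def stalk_def ring.simps monoid.simps
  by (rule germ_binary_op[OF rsheaf rsheaf rsheaf _ _ assms, where f = "\<lambda>U s t. s \<otimes>\<^bsub>OX U\<^esub> t"])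
    (auto simp: sec_closed ring_hom_mult[OF res_hom])

lemma rgerm_add:
  assumes "openin T U" "x \<in> U" "s \<in> carrier (OX U)" "t \<in> carrier (OX U)"
  shows "rgerm X x U s \<oplus>\<^bsub>stalk X x\<^esub> rgerm X x U t = rgerm X x U (s \<oplus>\<^bsub>OX U\<^esub> t)"
  unfolding rgerm_def stalk_def ring.simps monoid.simps
  by (rule germ_binary_op[OF rsheaf rsheaf rsheaf _ _ assms, where f = "\<lambda>U s t. s \<oplus>\<^bsub>OX U\<^esub> t"])
    (auto simp: sec_closed ring_hom_add[OF res_hom])

lemma lgerm_add:
  assumes "openin T U" "x \<in> U" "s \<in> carrier (lsec L U)" "t \<in> carrier (lsec L U)"
  shows "lgerm X L x U s \<oplus>\<^bsub>lstalk X L x\<^esub> lgerm X L x U t = lgerm X L x U (s \<oplus>\<^bsub>lsec L U\<^esub> t)"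
  unfolding lgerm_def lstalk_def ring.simps monoid.simps
  by (rule germ_binary_op[OF lsheaf lsheaf lsheaf _ _ assms, where f = "\<lambda>U s t. s \<oplus>\<^bsub>lsec L U\<^esub> t"])
    (auto simp: lres_add abelian_groupE(1)[OF Module.module.axioms(2)[OF sec_module]])

lemma lgerm_smult:
  assumes "openin T U" "x \<in> U" "s \<in> carrier (OX U)" "t \<in> carrier (lsec L U)"
  shows "rgerm X x U s \<odot>\<^bsub>lstalk X L x\<^esub> lgerm X L x U t = lgerm X L x U (s \<odot>\<^bsub>lsec L U\<^esub> t)"
  unfolding rgerm_def lgerm_def lstalk_def module.simps
  by (rule germ_binary_op[OF rsheaf lsheaf lsheaf _ _ assms, where f = "\<lambda>U s t. s \<odot>\<^bsub>lsec L U\<^esub> t"])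
    (auto simp: lres_smult Module.module.smult_closed[OF sec_module])

text \<open>The stalk takes its unit from the whole space, and restriction homomorphisms carry that
  unit to the one over \<open>U\<close>.\<close>

lemma rgerm_one: "openin T U \<Longrightarrow> x \<in> U \<Longrightarrow> rgerm X x U \<one>\<^bsub>OX U\<^esub> = \<one>\<^bsub>stalk X x\<^esub>"
  using germ_res[OF rsheaf, of "topspace T" U x "\<one>\<^bsub>OX (topspace T)\<^esub>"] openin_subset[of T U]
    ring_hom_one[OF res_hom, of "topspace T" U] cring.cring_simprules(6)[OF sec_cring]
  by (simp add: rgerm_def stalk_def)

lemma rgerm_zero: "openin T U \<Longrightarrow> x \<in> U \<Longrightarrow> rgerm X x U \<zero>\<^bsub>OX U\<^esub> = \<zero>\<^bsub>stalk X x\<^esub>"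
  using germ_res[OF rsheaf, of "topspace T" U x "\<zero>\<^bsub>OX (topspace T)\<^esub>"] openin_subset[of T U]
    ring_hom_zero[OF res_hom, of "topspace T" U] cring.cring_simprules(2)[OF sec_cring]
    cring.axioms(1)[OF sec_cring]
  by (simp add: rgerm_def stalk_def)

lemma rgerm_closed:
  "openin T U \<Longrightarrow> x \<in> U \<Longrightarrow> s \<in> carrier (OX U) \<Longrightarrow> rgerm X x U s \<in> carrier (stalk X x)"
  by (auto simp: rgerm_def stalk_def germs_def)

lemma lgerm_closed:
  "openin T U \<Longrightarrow> x \<in> U \<Longrightarrow> s \<in> carrier (lsec L U) \<Longrightarrow> lgerm X L x U s \<in> carrier (lstalk X L x)"
  by (auto simp: lgerm_def lstalk_def germs_def)

lemma rgerm_res: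
  "openin T U \<Longrightarrow> openin T V \<Longrightarrow> V \<subseteq> U \<Longrightarrow> x \<in> V \<Longrightarrow> s \<in> carrier (OX U) \<Longrightarrow>
    rgerm X x V (rres X U V s) = rgerm X x U s"
  unfolding rgerm_def by (rule germ_res[OF rsheaf])

lemma lgerm_res:
  "openin T U \<Longrightarrow> openin T V \<Longrightarrow> V \<subseteq> U \<Longrightarrow> x \<in> V \<Longrightarrow> s \<in> carrier (lsec L U) \<Longrightarrow>
    lgerm X L x V (lres L U V s) = lgerm X L x U s"
  unfolding lgerm_def by (rule germ_res[OF lsheaf])

lemma stalk_rep_inside:
  assumes "a \<in> carrier (stalk X x)" "openin T U" "x \<in> U"
  obtains V s where "openin T V" "x \<in> V" "V \<subseteq> U" "s \<in> carrier (OX V)" "a = rgerm X x V s"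
  using germs_rep_inside[OF rsheaf _ assms(2,3), of a] assms(1)
  unfolding rgerm_def stalk_def by auto

lemma rres_closed:
  "openin T U \<Longrightarrow> openin T V \<Longrightarrow> V \<subseteq> U \<Longrightarrow> s \<in> carrier (OX U) \<Longrightarrow> rres X U V s \<in> carrier (OX V)"
  by (rule ring_hom_closed[OF res_hom])

lemma lres_closed:
  "openin T U \<Longrightarrow> openin T V \<Longrightarrow> V \<subseteq> U \<Longrightarrow> s \<in> carrier (lsec L U) \<Longrightarrow>
    lres L U V s \<in> carrier (lsec L V)"
  by (rule is_sheaf_closed[OF lsheaf])

text \<open>Shrinking three times in succession yields one open set for all representatives. Three
  is the number of elements in the associative and distributive laws, and the bound \<open>U\<close>
  keeps them inside a trivializing neighbourhood.\<close>

lemma stalk_common_reps: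
  assumes "a \<in> carrier (stalk X x)" "b \<in> carrier (stalk X x)" "c \<in> carrier (stalk X x)"
    and U: "openin T U" "x \<in> U"
  obtains V r s t where "openin T V" "x \<in> V" "V \<subseteq> U"
    "r \<in> carrier (OX V)" "s \<in> carrier (OX V)" "t \<in> carrier (OX V)"
    "a = rgerm X x V r" "b = rgerm X x V s" "c = rgerm X x V t"
proof -
  obtain V1 r where 1: "openin T V1" "x \<in> V1" "V1 \<subseteq> U" "r \<in> carrier (OX V1)" "a = rgerm X x V1 r"
    using stalk_rep_inside[OF assms(1) U] .
  obtain V2 s where 2: "openin T V2" "x \<in> V2" "V2 \<subseteq> V1" "s \<in> carrier (OX V2)" "b = rgerm X x V2 s"
    using stalk_rep_inside[OF assms(2) 1(1,2)] .
  obtain V3 t where 3: "openin T V3" "x \<in> V3" "V3 \<subseteq> V2" "t \<in> carrier (OX V3)" "c = rgerm X x V3 t"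
    using stalk_rep_inside[OF assms(3) 2(1,2)] .
  show ?thesis
    using that[of V3 "rres X V1 V3 r" "rres X V2 V3 s" t] 1 2 3
    by (auto simp: rres_closed rgerm_res)
qed

text \<open>Every ring axiom involves at most three elements, hence follows from the same axiom over
  a common open set.\<close>

lemma stalk_cring:
  assumes x: "x \<in> topspace T"
  shows "cring (stalk X x)"
proof -
  let ?S = "stalk X x"
  have rep: "\<exists>V r s t. openin T V \<and> x \<in> V \<and> cring (OX V) \<and>
      r \<in> carrier (OX V) \<and> s \<in> carrier (OX V) \<and> t \<in> carrier (OX V) \<and>
      a = rgerm X x V r \<and> b = rgerm X x V s \<and> c = rgerm X x V t"
    if "a \<in> carrier ?S" "b \<in> carrier ?S" "c \<in> carrier ?S" for a b c
    using stalk_common_reps[OF that openin_topspace x] sec_cring by metis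
  have one: "\<one>\<^bsub>?S\<^esub> = rgerm X x (topspace T) \<one>\<^bsub>OX (topspace T)\<^esub>"
    and zero: "\<zero>\<^bsub>?S\<^esub> = rgerm X x (topspace T) \<zero>\<^bsub>OX (topspace T)\<^esub>"
    by (simp_all add: stalk_def)
  have one_S: "\<one>\<^bsub>?S\<^esub> \<in> carrier ?S" and zero_S: "\<zero>\<^bsub>?S\<^esub> \<in> carrier ?S"
    unfolding one zero using x cring.cring_simprules(2,6)[OF sec_cring]
    by (auto intro!: rgerm_closed)
  have cl: "a \<oplus>\<^bsub>?S\<^esub> b \<in> carrier ?S" "a \<otimes>\<^bsub>?S\<^esub> b \<in> carrier ?S"
    if "a \<in> carrier ?S" "b \<in> carrier ?S" for a b
    using rep[OF that that(2)] by (auto simp: rgerm_add rgerm_mult intro!: rgerm_closed sec_closed)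
  have comm: "a \<oplus>\<^bsub>?S\<^esub> b = b \<oplus>\<^bsub>?S\<^esub> a" "a \<otimes>\<^bsub>?S\<^esub> b = b \<otimes>\<^bsub>?S\<^esub> a"
    if "a \<in> carrier ?S" "b \<in> carrier ?S" for a b
    using rep[OF that that(2)]
    by (auto simp: rgerm_add rgerm_mult cring.cring_simprules(10,14))
  have assoc: "a \<oplus>\<^bsub>?S\<^esub> b \<oplus>\<^bsub>?S\<^esub> c = a \<oplus>\<^bsub>?S\<^esub> (b \<oplus>\<^bsub>?S\<^esub> c)"
    "a \<otimes>\<^bsub>?S\<^esub> b \<otimes>\<^bsub>?S\<^esub> c = a \<otimes>\<^bsub>?S\<^esub> (b \<otimes>\<^bsub>?S\<^esub> c)"
    "(a \<oplus>\<^bsub>?S\<^esub> b) \<otimes>\<^bsub>?S\<^esub> c = a \<otimes>\<^bsub>?S\<^esub> c \<oplus>\<^bsub>?S\<^esub> b \<otimes>\<^bsub>?S\<^esub> c"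
    if "a \<in> carrier ?S" "b \<in> carrier ?S" "c \<in> carrier ?S" for a b c
    using rep[OF that]
    by (auto simp: rgerm_add rgerm_mult sec_closed cring.cring_simprules(7,11,13))
  have unit: "\<zero>\<^bsub>?S\<^esub> \<oplus>\<^bsub>?S\<^esub> a = a" "\<one>\<^bsub>?S\<^esub> \<otimes>\<^bsub>?S\<^esub> a = a" "\<exists>b\<in>carrier ?S. b \<oplus>\<^bsub>?S\<^esub> a = \<zero>\<^bsub>?S\<^esub>"
    if a: "a \<in> carrier ?S" for a
  proof -
    obtain V r where V: "openin T V" "x \<in> V" "cring (OX V)" "r \<in> carrier (OX V)" "a = rgerm X x V r"
      using rep[OF a a a] by blast
    show "\<zero>\<^bsub>?S\<^esub> \<oplus>\<^bsub>?S\<^esub> a = a" "\<one>\<^bsub>?S\<^esub> \<otimes>\<^bsub>?S\<^esub> a = a"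
      using V by (simp_all add: rgerm_add rgerm_mult cring.cring_simprules(2,6,8,12)
        flip: rgerm_zero[OF V(1,2)] rgerm_one[OF V(1,2)])
    show "\<exists>b\<in>carrier ?S. b \<oplus>\<^bsub>?S\<^esub> a = \<zero>\<^bsub>?S\<^esub>"
      using V by (intro bexI[of _ "rgerm X x V (\<ominus>\<^bsub>OX V\<^esub> r)"])
        (simp_all add: rgerm_add rgerm_closed cring.cring_simprules(3,9) flip: rgerm_zero[OF V(1,2)])
  qed
  show ?thesis
    by (intro cringI abelian_groupI comm_monoidI)
      (use one_S zero_S cl comm assoc unit in auto)
qed

text \<open>The germ of a local generator \<open>e\<close> generates the stalk. The trivialization
  is a bijection over every open subset of \<open>U\<close>, so it stays available after the
  shrinking that passing between germs and sections requires.\<close>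

lemma lstalk_free:
  assumes x: "x \<in> topspace T"
  shows "\<exists>e. free_rank_one (stalk X x) (lstalk X L x) e"
proof -
  obtain U e where U: "openin T U" "x \<in> U" "e \<in> carrier (lsec L U)"
    and bij: "\<And>V. openin T V \<Longrightarrow> V \<subseteq> U \<Longrightarrow>
      bij_betw (\<lambda>f. f \<odot>\<^bsub>lsec L V\<^esub> lres L U V e) (carrier (OX V)) (carrier (lsec L V))"
    using line_sheafD(4) x by meson
  define g where "g = lgerm X L x U e"
  let ?S = "stalk X x" and ?M = "lstalk X L x"
  interpret S: cring ?S by (rule stalk_cring[OF x])
  have g: "g = lgerm X L x V (lres L U V e)" if "openin T V" "x \<in> V" "V \<subseteq> U" for V
    using that U by (simp add: g_def lgerm_res)
  have rep: "\<exists>V s t. openin T V \<and> x \<in> V \<and> V \<subseteq> U \<and> s \<in> carrier (OX V) \<and> t \<in> carrier (OX V) \<and>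
      a = rgerm X x V s \<and> b = rgerm X x V t \<and> lres L U V e \<in> carrier (lsec L V) \<and>
      g = lgerm X L x V (lres L U V e) \<and> Module.module (OX V) (lsec L V)"
    if "a \<in> carrier ?S" "b \<in> carrier ?S" for a b
    using stalk_common_reps[OF that that(2) U(1,2)] g lres_closed[OF U(1)] U(3) sec_module by metis
  have smult_gen: "a \<odot>\<^bsub>?M\<^esub> g \<in> carrier ?M" "(a \<oplus>\<^bsub>?S\<^esub> b) \<odot>\<^bsub>?M\<^esub> g = a \<odot>\<^bsub>?M\<^esub> g \<oplus>\<^bsub>?M\<^esub> b \<odot>\<^bsub>?M\<^esub> g"
    "(a \<otimes>\<^bsub>?S\<^esub> b) \<odot>\<^bsub>?M\<^esub> g = a \<odot>\<^bsub>?M\<^esub> (b \<odot>\<^bsub>?M\<^esub> g)"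
    if ab: "a \<in> carrier ?S" "b \<in> carrier ?S" for a b
  proof -
    obtain V s t where V: "openin T V" "x \<in> V" "s \<in> carrier (OX V)" "t \<in> carrier (OX V)"
      "a = rgerm X x V s" "b = rgerm X x V t" "lres L U V e \<in> carrier (lsec L V)"
      "g = lgerm X L x V (lres L U V e)" "Module.module (OX V) (lsec L V)"
      using rep[OF ab] by blast
    show "a \<odot>\<^bsub>?M\<^esub> g \<in> carrier ?M" "(a \<oplus>\<^bsub>?S\<^esub> b) \<odot>\<^bsub>?M\<^esub> g = a \<odot>\<^bsub>?M\<^esub> g \<oplus>\<^bsub>?M\<^esub> b \<odot>\<^bsub>?M\<^esub> g"
      "(a \<otimes>\<^bsub>?S\<^esub> b) \<odot>\<^bsub>?M\<^esub> g = a \<odot>\<^bsub>?M\<^esub> (b \<odot>\<^bsub>?M\<^esub> g)"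
      using V(1-4,7,9) unfolding V(5,6,8)
      by (simp_all add: rgerm_add rgerm_mult lgerm_add lgerm_smult lgerm_closed sec_closed
          Module.module.smult_closed Module.module.smult_l_distr Module.module.smult_assoc1)
  qed
  have inj: "a = b" if ab: "a \<in> carrier ?S" "b \<in> carrier ?S" "a \<odot>\<^bsub>?M\<^esub> g = b \<odot>\<^bsub>?M\<^esub> g" for a b
  proof -
    obtain V s t where V: "openin T V" "x \<in> V" "V \<subseteq> U" "s \<in> carrier (OX V)" "t \<in> carrier (OX V)"
      "a = rgerm X x V s" "b = rgerm X x V t" "lres L U V e \<in> carrier (lsec L V)"
      "g = lgerm X L x V (lres L U V e)" "Module.module (OX V) (lsec L V)"
      using rep[OF ab(1,2)] by blast
    let ?e = "lres L U V e"
    have se: "s \<odot>\<^bsub>lsec L V\<^esub> ?e \<in> carrier (lsec L V)" "t \<odot>\<^bsub>lsec L V\<^esub> ?e \<in> carrier (lsec L V)"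
      using V by (simp_all add: Module.module.smult_closed)
    have "lgerm X L x V (s \<odot>\<^bsub>lsec L V\<^esub> ?e) = lgerm X L x V (t \<odot>\<^bsub>lsec L V\<^esub> ?e)"
      using ab(3) V(1-5,8) unfolding V(6,7,9) by (simp add: lgerm_smult)
    \<comment> \<open>Equal germs agree only on some smaller \<open>W\<close>; injectivity of the
      trivialization is applied there.\<close>
    then obtain W where W: "openin T W" "x \<in> W" "W \<subseteq> V"
      "lres L V W (s \<odot>\<^bsub>lsec L V\<^esub> ?e) = lres L V W (t \<odot>\<^bsub>lsec L V\<^esub> ?e)"
      unfolding lgerm_def germ_eq_iff[OF lsheaf V(1,2) se(1) V(1,2) se(2)] by blast
    have "lres L V W ?e = lres L U W e"
      using is_sheaf_res_res[OF lsheaf U(1) V(1) W(1) W(3) V(3) U(3)] .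
    then have "rres X V W s \<odot>\<^bsub>lsec L W\<^esub> lres L U W e = rres X V W t \<odot>\<^bsub>lsec L W\<^esub> lres L U W e"
      using W V by (simp add: lres_smult)
    moreover have "inj_on (\<lambda>f. f \<odot>\<^bsub>lsec L W\<^esub> lres L U W e) (carrier (OX W))"
      using bij[OF W(1)] W(3) V(3) by (auto simp: bij_betw_def)
    ultimately have "rres X V W s = rres X V W t"
      using rres_closed[OF V(1) W(1,3)] V(4,5) by (auto dest: inj_onD)
    then have "rgerm X x W (rres X V W s) = rgerm X x W (rres X V W t)" by simp
    then show "a = b"
      unfolding V(6,7) using V W by (simp add: rgerm_res)
  qed
  have surj: "\<exists>a\<in>carrier ?S. m = a \<odot>\<^bsub>?M\<^esub> g" if m: "m \<in> carrier ?M" for m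
  proof -
    obtain V s where V: "openin T V" "x \<in> V" "V \<subseteq> U" "s \<in> carrier (lsec L V)" "m = lgerm X L x V s"
      using germs_rep_inside[OF lsheaf _ U(1,2), of m] m unfolding lgerm_def lstalk_def by auto
    obtain f where f: "f \<in> carrier (OX V)" "s = f \<odot>\<^bsub>lsec L V\<^esub> lres L U V e"
      using bij[OF V(1,3)] V(4) unfolding bij_betw_def by blast
    have "m = rgerm X x V f \<odot>\<^bsub>?M\<^esub> g"
      unfolding g[OF V(1-3)] V(5) f(2) using V f lres_closed[OF U(1) V(1,3) U(3)]
      by (simp add: lgerm_smult)
    then show ?thesis using V f by (auto intro: rgerm_closed)
  qed
  have "free_rank_one ?S ?M g"
  proof
    show "g \<in> carrier ?M" unfolding g_def using U by (simp add: lgerm_closed)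
    show "\<exists>!r. r \<in> carrier ?S \<and> m = r \<odot>\<^bsub>?M\<^esub> g" if "m \<in> carrier ?M" for m
      using surj[OF that] inj by blast
  qed (use smult_gen in auto)
  then show ?thesis ..
qed

end

section \<open>Global sections of tensor powers\<close>

context line_sheaf_on
begin

text \<open>Chosen independently at each point. It only serves to compare classes at that point and
  need not come from a section varying with \<open>x\<close>.\<close>

definition gen :: "'p \<Rightarrow> ('p set \<times> 's) set" where
  "gen x = (SOME e. free_rank_one (stalk X x) (lstalk X L x) e)"

lemma free_gen: "x \<in> topspace T \<Longrightarrow> free_rank_one (stalk X x) (lstalk X L x) (gen x)"
  unfolding gen_def by (rule someI_ex[OF lstalk_free])

abbreviation tstalk_class where
  "tstalk_class n x \<equiv> tclass (stalk X x) (lstalk X L x) n"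

abbreviation tstalk_exps where
  "tstalk_exps n x \<equiv> texps (stalk X x) (lstalk X L x) n"

definition tgerm :: "'p set \<Rightarrow> 'p \<Rightarrow> ('r \<times> 's list) list \<Rightarrow>
    (('p set \<times> 'r) set \<times> ('p set \<times> 's) set list) list" where
  "tgerm V y E = map (\<lambda>(c, l). (rgerm X y V c, map (lgerm X L y V) l)) E"

definition tres :: "'p set \<Rightarrow> 'p set \<Rightarrow> ('r \<times> 's list) list \<Rightarrow> ('r \<times> 's list) list" where
  "tres V W E = map (\<lambda>(c, l). (rres X V W c, map (lres L V W) l)) E"

lemma tgerm_simps [simp]:
  "tgerm V y [] = []"
  "tgerm V y ((c, l) # E) = (rgerm X y V c, map (lgerm X L y V) l) # tgerm V y E"
  "tgerm V y (E @ F) = tgerm V y E @ tgerm V y F"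
  by (simp_all add: tgerm_def)

lemma tres_simps [simp]:
  "tres V W [] = []"
  "tres V W ((c, l) # E) = (rres X V W c, map (lres L V W) l) # tres V W E"
  by (simp_all add: tres_def)

lemma tgerm_closed:
  assumes "openin T V" "y \<in> V" "E \<in> texps (OX V) (lsec L V) n"
  shows "tgerm V y E \<in> tstalk_exps n y"
  using assms(3)
proof (induction E)
  case (Cons p E)
  then show ?case
    using assms(1,2) by (cases p) (auto simp: rgerm_closed lgerm_closed)
qed simp

lemma tres_closed:
  assumes "openin T V" "openin T W" "W \<subseteq> V" "E \<in> texps (OX V) (lsec L V) n"
  shows "tres V W E \<in> texps (OX W) (lsec L W) n"
  using assms(4)
proof (induction E)
  case (Cons p E)
  then show ?case
    using assms(1-3) by (cases p) (auto simp: rres_closed lres_closed)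
qed simp

lemma tgerm_tres:
  assumes "openin T V" "openin T W" "W \<subseteq> V" "y \<in> W" "E \<in> texps (OX V) (lsec L V) n"
  shows "tgerm W y (tres V W E) = tgerm V y E"
  using assms(5)
proof (induction E)
  case (Cons p E)
  then show ?case
    using assms(1-4) by (cases p) (auto simp: rgerm_res lgerm_res)
qed simp

lemma tgerm_tconcat_single:
  assumes "openin T V" "y \<in> V" "c \<in> carrier (OX V)" "F \<in> texps (OX V) (lsec L V) n"
  shows "tgerm V y (map (\<lambda>(d, l). (c \<otimes>\<^bsub>OX V\<^esub> d, k @ l)) F) =
    map (\<lambda>(d, l). (rgerm X y V c \<otimes>\<^bsub>stalk X y\<^esub> d, map (lgerm X L y V) k @ l)) (tgerm V y F)"
  using assms(4)
proof (induction F)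
  case (Cons p F)
  then show ?case
    using assms(1-3) by (cases p) (auto simp: rgerm_mult)
qed simp

lemma tgerm_tconcat:
  assumes "openin T V" "y \<in> V" "E \<in> texps (OX V) (lsec L V) m" "F \<in> texps (OX V) (lsec L V) n"
  shows "tgerm V y (tconcat (OX V) E F) = tconcat (stalk X y) (tgerm V y E) (tgerm V y F)"
  using assms(3)
proof (induction E)
  case (Cons p E)
  then show ?case
    using assms by (cases p) (auto simp: tgerm_tconcat_single)
qed simp

lemma in_topspace: "openin T V \<Longrightarrow> y \<in> V \<Longrightarrow> y \<in> topspace T"
  using openin_subset by blast

lemma rgerm_minus:
  assumes "openin T V" "y \<in> V" "c \<in> carrier (OX V)"
  shows "rgerm X y V (\<ominus>\<^bsub>OX V\<^esub> c) = \<ominus>\<^bsub>stalk X y\<^esub> rgerm X y V c"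
proof -
  interpret S: cring "stalk X y"
    by (rule stalk_cring[OF in_topspace[OF assms(1,2)]])
  interpret V: cring "OX V"
    by (rule sec_cring[OF assms(1)])
  have "rgerm X y V (\<ominus>\<^bsub>OX V\<^esub> c) \<oplus>\<^bsub>stalk X y\<^esub> rgerm X y V c = \<zero>\<^bsub>stalk X y\<^esub>"
    using assms by (simp add: rgerm_add V.l_neg rgerm_zero)
  then show ?thesis
    using assms by (intro S.minus_equality[symmetric]) (auto simp: rgerm_closed)
qed

lemma tgerm_tneg:
  assumes "openin T V" "y \<in> V" "E \<in> texps (OX V) (lsec L V) n"
  shows "tgerm V y (tneg (OX V) E) = tneg (stalk X y) (tgerm V y E)"
  using assms(3)
proof (induction E)
  case (Cons p E)
  then show ?case
    using assms(1,2) by (cases p) (auto simp: rgerm_minus)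
qed simp

section \<open>Global sections as locally induced families of classes\<close>

abbreviation tsections ("\<Gamma>") where
  "\<Gamma> n \<equiv> lsec (tpow X L n) (topspace T)"

lemma tsection_iff:
  "s \<in> carrier (\<Gamma> n) \<longleftrightarrow> s \<in> extensional (topspace T) \<and>
    (\<forall>x\<in>topspace T. \<exists>V E. openin T V \<and> x \<in> V \<and> E \<in> texps (OX V) (lsec L V) n \<and>
       (\<forall>y\<in>V. s y = tstalk_class n y (tgerm V y E)))"
proof -
  have "openin T V \<and> x \<in> V \<and> V \<subseteq> topspace T \<and> P \<longleftrightarrow> openin T V \<and> x \<in> V \<and> P" for V x P
    using openin_subset by blast
  then show ?thesis
    unfolding tpow_def tgerm_def by simp
qed

lemma tsection_localE:
  assumes "s \<in> carrier (\<Gamma> n)" "x \<in> topspace T"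
  obtains V E where "openin T V" "x \<in> V" "E \<in> texps (OX V) (lsec L V) n"
    "\<And>y. y \<in> V \<Longrightarrow> s y = tstalk_class n y (tgerm V y E)"
  using assms unfolding tsection_iff by blast

lemma tsection_local2E:
  assumes "s \<in> carrier (\<Gamma> m)" "t \<in> carrier (\<Gamma> n)" "x \<in> topspace T"
  obtains V E F where "openin T V" "x \<in> V"
    "E \<in> texps (OX V) (lsec L V) m" "F \<in> texps (OX V) (lsec L V) n"
    "\<And>y. y \<in> V \<Longrightarrow> s y = tstalk_class m y (tgerm V y E)"
    "\<And>y. y \<in> V \<Longrightarrow> t y = tstalk_class n y (tgerm V y F)"
proof -
  obtain V E where V: "openin T V" "x \<in> V" "E \<in> texps (OX V) (lsec L V) m"
    "\<And>y. y \<in> V \<Longrightarrow> s y = tstalk_class m y (tgerm V y E)"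
    using tsection_localE[OF assms(1,3)] by blast
  obtain W F where W: "openin T W" "x \<in> W" "F \<in> texps (OX W) (lsec L W) n"
    "\<And>y. y \<in> W \<Longrightarrow> t y = tstalk_class n y (tgerm W y F)"
    using tsection_localE[OF assms(2,3)] by blast
  have VW: "openin T (V \<inter> W)" using V W by blast
  show ?thesis
  proof (rule that[of "V \<inter> W" "tres V (V \<inter> W) E" "tres W (V \<inter> W) F"])
    show "s y = tstalk_class m y (tgerm (V \<inter> W) y (tres V (V \<inter> W) E))" if "y \<in> V \<inter> W" for y
      using that V VW by (subst tgerm_tres[of _ _ _ _ m]) auto
    show "t y = tstalk_class n y (tgerm (V \<inter> W) y (tres W (V \<inter> W) F))" if "y \<in> V \<inter> W" for y
      using that W VW by (subst tgerm_tres[of _ _ _ _ n]) auto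
  qed (use V W VW in \<open>auto intro: tres_closed\<close>)
qed

lemma tsection_valueE:
  assumes "s \<in> carrier (\<Gamma> n)" "x \<in> topspace T"
  obtains E where "E \<in> tstalk_exps n x" "s x = tstalk_class n x E"
  using tsection_localE[OF assms] tgerm_closed by metis

lemma tsection_zero: "\<zero>\<^bsub>\<Gamma> n\<^esub> = (\<lambda>x\<in>topspace T. tstalk_class n x [])"
  by (simp add: tpow_def)

lemma tsection_add:
  "s \<oplus>\<^bsub>\<Gamma> n\<^esub> t = (\<lambda>x\<in>topspace T. tadd (stalk X x) (lstalk X L x) n (s x) (t x))"
  by (simp add: tpow_def)

lemma tadd_stalk:
  assumes "x \<in> topspace T" "E \<in> tstalk_exps n x" "F \<in> tstalk_exps n x"
  shows "tadd (stalk X x) (lstalk X L x) n (tstalk_class n x E) (tstalk_class n x F) =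
    tstalk_class n x (E @ F)"
  by (rule free_rank_one.tadd_tclass[OF free_gen[OF assms(1)] assms(2,3)])

lemma tmult_stalk:
  assumes "x \<in> topspace T" "E \<in> tstalk_exps m x" "F \<in> tstalk_exps n x"
  shows "tmult (stalk X x) (lstalk X L x) m n (tstalk_class m x E) (tstalk_class n x F) =
    tstalk_class (m + n) x (tconcat (stalk X x) E F)"
  by (rule free_rank_one.tmult_tclass[OF free_gen[OF assms(1)] assms(2,3)])

lemma tsection_add_closed:
  assumes "s \<in> carrier (\<Gamma> n)" "t \<in> carrier (\<Gamma> n)"
  shows "s \<oplus>\<^bsub>\<Gamma> n\<^esub> t \<in> carrier (\<Gamma> n)"
  unfolding tsection_iff
proof (intro conjI ballI)
  show "s \<oplus>\<^bsub>\<Gamma> n\<^esub> t \<in> extensional (topspace T)" by (simp add: tsection_add)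
  fix x assume x: "x \<in> topspace T"
  obtain V E F where V: "openin T V" "x \<in> V"
    "E \<in> texps (OX V) (lsec L V) n" "F \<in> texps (OX V) (lsec L V) n"
    "\<And>y. y \<in> V \<Longrightarrow> s y = tstalk_class n y (tgerm V y E)"
    "\<And>y. y \<in> V \<Longrightarrow> t y = tstalk_class n y (tgerm V y F)"
    using tsection_local2E[OF assms x] by blast
  have "(s \<oplus>\<^bsub>\<Gamma> n\<^esub> t) y = tstalk_class n y (tgerm V y (E @ F))" if "y \<in> V" for y
    using that V in_topspace[OF V(1)] tgerm_closed[OF V(1)] by (simp add: tsection_add tadd_stalk)
  then show "\<exists>V E. openin T V \<and> x \<in> V \<and> E \<in> texps (OX V) (lsec L V) n \<and>
      (\<forall>y\<in>V. (s \<oplus>\<^bsub>\<Gamma> n\<^esub> t) y = tstalk_class n y (tgerm V y E))"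
    using V by (intro exI[of _ V] exI[of _ "E @ F"]) auto
qed

text \<open>Multiplication of formal sums commutes with passing to germs, so \<open>tconcat\<close>
  of local representatives induces the product near each point.\<close>

lemma tprod_closed:
  assumes "s \<in> carrier (\<Gamma> m)" "t \<in> carrier (\<Gamma> n)"
  shows "tprod X L m n s t \<in> carrier (\<Gamma> (m + n))"
  unfolding tsection_iff
proof (intro conjI ballI)
  show "tprod X L m n s t \<in> extensional (topspace T)" by (simp add: tprod_def)
  fix x assume x: "x \<in> topspace T"
  obtain V E F where V: "openin T V" "x \<in> V"
    "E \<in> texps (OX V) (lsec L V) m" "F \<in> texps (OX V) (lsec L V) n"
    "\<And>y. y \<in> V \<Longrightarrow> s y = tstalk_class m y (tgerm V y E)"
    "\<And>y. y \<in> V \<Longrightarrow> t y = tstalk_class n y (tgerm V y F)"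
    using tsection_local2E[OF assms x] by blast
  have "tprod X L m n s t y = tstalk_class (m + n) y (tgerm V y (tconcat (OX V) E F))"
    if "y \<in> V" for y
    using that V in_topspace[OF V(1)] tgerm_closed[OF V(1)]
    by (simp add: tprod_def tmult_stalk tgerm_tconcat)
  then show "\<exists>V E. openin T V \<and> x \<in> V \<and> E \<in> texps (OX V) (lsec L V) (m + n) \<and>
      (\<forall>y\<in>V. tprod X L m n s t y = tstalk_class (m + n) y (tgerm V y E))"
    using V tconcat_closed[OF sec_cring[OF V(1)] V(3,4)]
    by (intro exI[of _ V] exI[of _ "tconcat (OX V) E F"]) auto
qed

lemma tsection_zero_closed: "\<zero>\<^bsub>\<Gamma> n\<^esub> \<in> carrier (\<Gamma> n)"
  unfolding tsection_iff tsection_zero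
  by (auto intro!: exI[of _ "topspace T"] exI[of _ "[]"])

lemma tsection_extensional: "s \<in> carrier (\<Gamma> n) \<Longrightarrow> s \<in> extensional (topspace T)"
  by (simp add: tsection_iff)

text \<open>The inverse is built pointwise and then shown to be locally induced by negated formal
  sums.\<close>

lemma tsection_minus_ex:
  assumes s: "s \<in> carrier (\<Gamma> n)"
  shows "\<exists>t\<in>carrier (\<Gamma> n). t \<oplus>\<^bsub>\<Gamma> n\<^esub> s = \<zero>\<^bsub>\<Gamma> n\<^esub>"
proof -
  define t where "t = (\<lambda>x\<in>topspace T. tstalk_class n x (tneg (stalk X x) (SOME E. E \<in> s x)))"
  \<comment> \<open>The representatives chosen at different points are unrelated. Since the class
    does not depend on the choice, they may be replaced near a point by germs of one formal
    sum.\<close>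
  have t: "t x = tstalk_class n x (tneg (stalk X x) E)"
    if x: "x \<in> topspace T" and E: "E \<in> tstalk_exps n x" "s x = tstalk_class n x E" for x E
  proof -
    interpret free_rank_one "stalk X x" "lstalk X L x" "gen x"
      by (rule free_gen[OF x])
    have "E \<in> s x" using E by (simp add: tclass_eq)
    then have "(SOME E. E \<in> s x) \<in> s x" by (rule someI)
    then have "(SOME E. E \<in> s x) \<in> tstalk_exps n x" "teval (SOME E. E \<in> s x) = teval E"
      using E by (auto simp: tclass_eq)
    then show ?thesis
      using E(1) x unfolding t_def
      by (simp add: tclass_eq_iff tneg_closed[OF is_cring] teval_tneg)
  qed
  show ?thesis
  proof
    show "t \<in> carrier (\<Gamma> n)"
      unfolding tsection_iff
    proof (intro conjI ballI)
      show "t \<in> extensional (topspace T)" by (simp add: t_def)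
      fix x assume x: "x \<in> topspace T"
      obtain V E where V: "openin T V" "x \<in> V" "E \<in> texps (OX V) (lsec L V) n"
        "\<And>y. y \<in> V \<Longrightarrow> s y = tstalk_class n y (tgerm V y E)"
        using tsection_localE[OF s x] by blast
      have "t y = tstalk_class n y (tgerm V y (tneg (OX V) E))" if "y \<in> V" for y
        using that V in_topspace[OF V(1)] tgerm_closed[OF V(1)] by (simp add: t tgerm_tneg)
      then show "\<exists>V E. openin T V \<and> x \<in> V \<and> E \<in> texps (OX V) (lsec L V) n \<and>
          (\<forall>y\<in>V. t y = tstalk_class n y (tgerm V y E))"
        using V tneg_closed[OF sec_cring[OF V(1)] V(3)]
        by (intro exI[of _ V] exI[of _ "tneg (OX V) E"]) auto
    qed
    show "t \<oplus>\<^bsub>\<Gamma> n\<^esub> s = \<zero>\<^bsub>\<Gamma> n\<^esub>"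
    proof (rule extensionalityI[where A = "topspace T"])
      fix x assume x: "x \<in> topspace T"
      interpret free_rank_one "stalk X x" "lstalk X L x" "gen x"
        by (rule free_gen[OF x])
      obtain E where E: "E \<in> tstalk_exps n x" "s x = tstalk_class n x E"
        using tsection_valueE[OF s x] .
      have N: "tneg (stalk X x) E \<in> tstalk_exps n x"
        by (rule tneg_closed[OF is_cring E(1)])
      have "(t \<oplus>\<^bsub>\<Gamma> n\<^esub> s) x = tstalk_class n x (tneg (stalk X x) E @ E)"
        using x E N by (simp add: tsection_add t tadd_tclass)
      also have "\<dots> = tstalk_class n x []"
        using E(1) N teval_append[OF N E(1)] teval_closed[OF E(1)]
        by (simp add: tclass_eq_iff teval_tneg[OF E(1)] l_neg)
      finally show "(t \<oplus>\<^bsub>\<Gamma> n\<^esub> s) x = \<zero>\<^bsub>\<Gamma> n\<^esub> x"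
        using x by (simp add: tsection_zero)
    qed (simp_all add: tsection_add tsection_zero)
  qed
qed

text \<open>Gives meaning to finite sums and differences of sections. Addition is concatenation of
  representatives, so associativity and the unit law hold for the lists themselves, while
  commutativity and inverses pass through \<open>teval\<close>.\<close>

lemma tsections_abelian_group: "abelian_group (\<Gamma> n)"
proof (rule abelian_groupI)
  fix s assume s: "s \<in> carrier (\<Gamma> n)"
  show "\<zero>\<^bsub>\<Gamma> n\<^esub> \<oplus>\<^bsub>\<Gamma> n\<^esub> s = s"
  proof (rule extensionalityI[where A = "topspace T"])
    fix x assume x: "x \<in> topspace T"
    obtain E where "E \<in> tstalk_exps n x" "s x = tstalk_class n x E"
      using tsection_valueE[OF s x] .
    then show "(\<zero>\<^bsub>\<Gamma> n\<^esub> \<oplus>\<^bsub>\<Gamma> n\<^esub> s) x = s x"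
      using x by (simp add: tsection_add tsection_zero tadd_stalk)
  qed (use s in \<open>simp_all add: tsection_add tsection_extensional\<close>)
  show "\<exists>t\<in>carrier (\<Gamma> n). t \<oplus>\<^bsub>\<Gamma> n\<^esub> s = \<zero>\<^bsub>\<Gamma> n\<^esub>"
    by (rule tsection_minus_ex[OF s])
  fix t assume t: "t \<in> carrier (\<Gamma> n)"
  show "s \<oplus>\<^bsub>\<Gamma> n\<^esub> t = t \<oplus>\<^bsub>\<Gamma> n\<^esub> s"
  proof (rule extensionalityI[where A = "topspace T"])
    fix x assume x: "x \<in> topspace T"
    interpret free_rank_one "stalk X x" "lstalk X L x" "gen x"
      by (rule free_gen[OF x])
    obtain E F where E: "E \<in> tstalk_exps n x" "s x = tstalk_class n x E"
      and F: "F \<in> tstalk_exps n x" "t x = tstalk_class n x F"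
      using tsection_valueE[OF s x] tsection_valueE[OF t x] by metis
    have "tstalk_class n x (E @ F) = tstalk_class n x (F @ E)"
      using E(1) F(1) teval_append[OF E(1) F(1)] teval_append[OF F(1) E(1)]
        a_comm[OF teval_closed[OF E(1)] teval_closed[OF F(1)]] by (simp add: tclass_eq_iff)
    then show "(s \<oplus>\<^bsub>\<Gamma> n\<^esub> t) x = (t \<oplus>\<^bsub>\<Gamma> n\<^esub> s) x"
      using x E F by (simp add: tsection_add tadd_stalk)
  qed (simp_all add: tsection_add)
  fix u assume u: "u \<in> carrier (\<Gamma> n)"
  show "s \<oplus>\<^bsub>\<Gamma> n\<^esub> t \<oplus>\<^bsub>\<Gamma> n\<^esub> u = s \<oplus>\<^bsub>\<Gamma> n\<^esub> (t \<oplus>\<^bsub>\<Gamma> n\<^esub> u)"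
  proof (rule extensionalityI[where A = "topspace T"])
    fix x assume x: "x \<in> topspace T"
    obtain E F G where "E \<in> tstalk_exps n x" "s x = tstalk_class n x E"
      and "F \<in> tstalk_exps n x" "t x = tstalk_class n x F"
      and "G \<in> tstalk_exps n x" "u x = tstalk_class n x G"
      using tsection_valueE[OF s x] tsection_valueE[OF t x] tsection_valueE[OF u x] by metis
    then show "(s \<oplus>\<^bsub>\<Gamma> n\<^esub> t \<oplus>\<^bsub>\<Gamma> n\<^esub> u) x = (s \<oplus>\<^bsub>\<Gamma> n\<^esub> (t \<oplus>\<^bsub>\<Gamma> n\<^esub> u)) x"
      using x by (simp add: tsection_add tadd_stalk)
  qed (simp_all add: tsection_add)
qed (auto intro: tsection_add_closed tsection_zero_closed)

text \<open>Both sides are represented by the same terms in a different order, so they are compared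
  through coordinates, where the claim is distributivity. This makes \<open>v \<mapsto> A v\<close>
  additive.\<close>

lemma tprod_add_right:
  assumes s: "s \<in> carrier (\<Gamma> m)" and t: "t \<in> carrier (\<Gamma> n)" and u: "u \<in> carrier (\<Gamma> n)"
  shows "tprod X L m n s (t \<oplus>\<^bsub>\<Gamma> n\<^esub> u) = tprod X L m n s t \<oplus>\<^bsub>\<Gamma> (m + n)\<^esub> tprod X L m n s u"
proof (rule extensionalityI[where A = "topspace T"])
  fix x assume x: "x \<in> topspace T"
  interpret free_rank_one "stalk X x" "lstalk X L x" "gen x"
    by (rule free_gen[OF x])
  obtain E F G where E: "E \<in> tstalk_exps m x" "s x = tstalk_class m x E"
    and F: "F \<in> tstalk_exps n x" "t x = tstalk_class n x F"
    and G: "G \<in> tstalk_exps n x" "u x = tstalk_class n x G"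
    using tsection_valueE[OF s x] tsection_valueE[OF t x] tsection_valueE[OF u x] by metis
  have FG: "F @ G \<in> tstalk_exps n x" using F G by simp
  note cl = tconcat_closed[OF is_cring E(1)]
  have "tstalk_class (m + n) x (tconcat (stalk X x) E (F @ G)) =
      tstalk_class (m + n) x (tconcat (stalk X x) E F @ tconcat (stalk X x) E G)"
    using cl[OF FG] cl[OF F(1)] cl[OF G(1)] teval_append[OF cl[OF F(1)] cl[OF G(1)]]
      teval_append[OF F(1) G(1)] teval_closed[OF E(1)] teval_closed[OF F(1)] teval_closed[OF G(1)]
    by (simp add: tclass_eq_iff teval_tconcat[OF E(1) FG] teval_tconcat[OF E(1) F(1)]
        teval_tconcat[OF E(1) G(1)] r_distr)
  then show "tprod X L m n s (t \<oplus>\<^bsub>\<Gamma> n\<^esub> u) x =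
      (tprod X L m n s t \<oplus>\<^bsub>\<Gamma> (m + n)\<^esub> tprod X L m n s u) x"
    using x E F G FG cl by (simp add: tprod_def tsection_add tadd_stalk tmult_stalk)
qed (simp_all add: tprod_def tsection_add)

end

section \<open>Norms and the pigeonhole argument\<close>

locale metrized_line_sheaf_on = line_sheaf_on X L
  for X :: "('p, 'r) rspace" and L :: "('p, 'r, 's) mlsheaf" +
  assumes metrized: "smoothly_metrized_line_sheaf X L"
begin

section \<open>Evaluation of sections at complex points\<close>

lemma cpointD:
  assumes "P \<in> cpoints X"
  shows "fst P \<in> topspace T" "snd P \<in> ring_hom (stalk X (fst P)) type_ring"
  using assms unfolding cpoints_def by auto

lemma cpoint_hom:
  assumes P: "P \<in> cpoints X"
  shows "a \<in> carrier (stalk X (fst P)) \<Longrightarrow> b \<in> carrier (stalk X (fst P)) \<Longrightarrow>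
      snd P (a \<otimes>\<^bsub>stalk X (fst P)\<^esub> b) = snd P a * snd P b"
    and "a \<in> carrier (stalk X (fst P)) \<Longrightarrow> b \<in> carrier (stalk X (fst P)) \<Longrightarrow>
      snd P (a \<oplus>\<^bsub>stalk X (fst P)\<^esub> b) = snd P a + snd P b"
    and "snd P \<one>\<^bsub>stalk X (fst P)\<^esub> = 1"
  using ring_hom_mult[OF cpointD(2)[OF P]] ring_hom_add[OF cpointD(2)[OF P]]
    ring_hom_one[OF cpointD(2)[OF P]] by (auto simp: type_ring_def)

text \<open>\<open>ring_hom\<close> asks only for products, sums and the unit; the value at zero is
  additively idempotent, hence 0.\<close>

lemma cpoint_hom_zero:
  assumes P: "P \<in> cpoints X"
  shows "snd P \<zero>\<^bsub>stalk X (fst P)\<^esub> = 0"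
proof -
  interpret cring "stalk X (fst P)" by (rule stalk_cring[OF cpointD(1)[OF P]])
  show ?thesis using cpoint_hom(2)[OF P zero_closed zero_closed] by simp
qed

text \<open>
  At a complex point, a section of the \<open>n\<close>-th tensor power is the multiple \<open>tval P s\<close> of the \<open>n\<close>-th
  power of the chosen generator of the stalk, so that its norm is \<open>cmod (tval P s) * gnorm P ^ n\<close>.
\<close>

definition gnorm :: "('p, 'r) cpoint \<Rightarrow> real" where
  "gnorm P = lnorm L P (gen (fst P))"

definition tval :: "('p, 'r) cpoint \<Rightarrow> ('p, 'r, 's) tpow_section \<Rightarrow> complex" where
  "tval P s = snd P (free_rank_one.teval (stalk X (fst P)) (lstalk X L (fst P)) (gen (fst P))
     (SOME E. E \<in> s (fst P)))"

lemma lnorm_smult: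
  assumes "P \<in> cpoints X" "s \<in> carrier (lstalk X L (fst P))" "a \<in> carrier (stalk X (fst P))"
  shows "lnorm L P (a \<odot>\<^bsub>lstalk X L (fst P)\<^esub> s) = cmod (snd P a) * lnorm L P s"
  using metrized[unfolded smoothly_metrized_line_sheaf_def, THEN conjunct2, THEN conjunct1] assms
  by blast

lemma gnorm_nonneg:
  assumes "P \<in> cpoints X"
  shows "0 \<le> gnorm P"
  using metrized[unfolded smoothly_metrized_line_sheaf_def, THEN conjunct2, THEN conjunct1] assms
    free_rank_one.gen_closed[OF free_gen[OF cpointD(1)[OF assms]]]
  unfolding gnorm_def by blast

text \<open>Members of one class have the same \<open>teval\<close>, so the arbitrary choice in
  \<open>tval\<close> does not matter.\<close>

lemma tval_eq:
  assumes P: "P \<in> cpoints X" and "E \<in> tstalk_exps n (fst P)" "s (fst P) = tstalk_class n (fst P) E"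
  shows "tval P s =
    snd P (free_rank_one.teval (stalk X (fst P)) (lstalk X L (fst P)) (gen (fst P)) E)"
proof -
  interpret free_rank_one "stalk X (fst P)" "lstalk X L (fst P)" "gen (fst P)"
    by (rule free_gen[OF cpointD(1)[OF P]])
  have "E \<in> s (fst P)" using assms by (simp add: tclass_eq)
  then have "(SOME E. E \<in> s (fst P)) \<in> s (fst P)" by (rule someI)
  then show ?thesis
    using assms by (simp add: tval_def tclass_eq)
qed

lemma tval_add:
  assumes P: "P \<in> cpoints X" and s: "s \<in> carrier (\<Gamma> n)" and t: "t \<in> carrier (\<Gamma> n)"
  shows "tval P (s \<oplus>\<^bsub>\<Gamma> n\<^esub> t) = tval P s + tval P t"
proof -
  interpret free_rank_one "stalk X (fst P)" "lstalk X L (fst P)" "gen (fst P)"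
    by (rule free_gen[OF cpointD(1)[OF P]])
  obtain E F where E: "E \<in> tstalk_exps n (fst P)" "s (fst P) = tstalk_class n (fst P) E"
    and F: "F \<in> tstalk_exps n (fst P)" "t (fst P) = tstalk_class n (fst P) F"
    using tsection_valueE[OF s cpointD(1)[OF P]] tsection_valueE[OF t cpointD(1)[OF P]] by metis
  have EF: "E @ F \<in> tstalk_exps n (fst P)" using E F by simp
  have "(s \<oplus>\<^bsub>\<Gamma> n\<^esub> t) (fst P) = tstalk_class n (fst P) (E @ F)"
    using E F cpointD(1)[OF P] by (simp add: tsection_add tadd_tclass)
  then have "tval P (s \<oplus>\<^bsub>\<Gamma> n\<^esub> t) = snd P (teval E \<oplus>\<^bsub>stalk X (fst P)\<^esub> teval F)"
    using tval_eq[OF P EF] teval_append[OF E(1) F(1)] by simp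
  also have "\<dots> = tval P s + tval P t"
    using tval_eq[where s = s, OF P E] tval_eq[where s = t, OF P F]
      cpoint_hom(2)[OF P teval_closed[OF E(1)] teval_closed[OF F(1)]] by simp
  finally show ?thesis .
qed

lemma tval_zero:
  assumes P: "P \<in> cpoints X"
  shows "tval P \<zero>\<^bsub>\<Gamma> n\<^esub> = 0"
proof -
  interpret free_rank_one "stalk X (fst P)" "lstalk X L (fst P)" "gen (fst P)"
    by (rule free_gen[OF cpointD(1)[OF P]])
  show ?thesis
    using tval_eq[OF P, of "[]" n "\<zero>\<^bsub>\<Gamma> n\<^esub>"] cpointD(1)[OF P] cpoint_hom_zero[OF P]
    by (simp add: tsection_zero)
qed

lemma tval_minus:
  assumes P: "P \<in> cpoints X" and s: "s \<in> carrier (\<Gamma> n)" and t: "t \<in> carrier (\<Gamma> n)"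
  shows "tval P (s \<ominus>\<^bsub>\<Gamma> n\<^esub> t) = tval P s - tval P t"
proof -
  interpret G: abelian_group "\<Gamma> n" by (rule tsections_abelian_group)
  have "(s \<ominus>\<^bsub>\<Gamma> n\<^esub> t) \<oplus>\<^bsub>\<Gamma> n\<^esub> t = s"
    using s t by (simp add: G.minus_eq G.a_assoc G.l_neg)
  then have "tval P s = tval P (s \<ominus>\<^bsub>\<Gamma> n\<^esub> t) + tval P t"
    using tval_add[OF P G.minus_closed[OF s t] t] by simp
  then show ?thesis by simp
qed

lemma tval_tprod:
  assumes P: "P \<in> cpoints X" and s: "s \<in> carrier (\<Gamma> m)" and t: "t \<in> carrier (\<Gamma> n)"
  shows "tval P (tprod X L m n s t) = tval P s * tval P t"
proof -
  interpret free_rank_one "stalk X (fst P)" "lstalk X L (fst P)" "gen (fst P)"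
    by (rule free_gen[OF cpointD(1)[OF P]])
  obtain E F where E: "E \<in> tstalk_exps m (fst P)" "s (fst P) = tstalk_class m (fst P) E"
    and F: "F \<in> tstalk_exps n (fst P)" "t (fst P) = tstalk_class n (fst P) F"
    using tsection_valueE[OF s cpointD(1)[OF P]] tsection_valueE[OF t cpointD(1)[OF P]] by metis
  have EF: "tconcat (stalk X (fst P)) E F \<in> tstalk_exps (m + n) (fst P)"
    by (rule tconcat_closed[OF is_cring E(1) F(1)])
  have "tprod X L m n s t (fst P) =
      tstalk_class (m + n) (fst P) (tconcat (stalk X (fst P)) E F)"
    using E F cpointD(1)[OF P] by (simp add: tprod_def tmult_tclass)
  then have "tval P (tprod X L m n s t) = snd P (teval E \<otimes>\<^bsub>stalk X (fst P)\<^esub> teval F)"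
    using tval_eq[OF P EF] teval_tconcat[OF E(1) F(1)] by simp
  also have "\<dots> = tval P s * tval P t"
    using tval_eq[where s = s, OF P E] tval_eq[where s = t, OF P F]
      cpoint_hom(1)[OF P teval_closed[OF E(1)] teval_closed[OF F(1)]] by simp
  finally show ?thesis .
qed

text \<open>Shows that the description defining the norm has exactly one solution. By homogeneity of
  \<open>lnorm\<close>, a pure tensor \<open>(c, l)\<close> has norm
  \<open>cmod (snd P (c \<otimes> coords l)) * gnorm P ^ n\<close>, and its coordinate is the same
  for every pure tensor in the class.\<close>

lemma lnorm_tpow:
  assumes P: "P \<in> cpoints X" and s: "s \<in> carrier (\<Gamma> n)"
  shows "lnorm (tpow X L n) P (lgerm X (tpow X L n) (fst P) (topspace T) s) =
    cmod (tval P s) * gnorm P ^ n"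
proof -
  define x where "x = fst P"
  have x: "x \<in> topspace T" unfolding x_def by (rule cpointD(1)[OF P])
  interpret free_rank_one "stalk X x" "lstalk X L x" "gen x"
    by (rule free_gen[OF x])
  obtain E where E: "E \<in> tstalk_exps n x" "s x = tstalk_class n x E"
    using tsection_valueE[OF s x] .
  have val: "tval P s = snd P (teval E)"
    using tval_eq[OF P] E unfolding x_def by blast
  note hom = cpoint_hom[OF P, folded x_def]
  have lnorm_coord: "lnorm L P a = cmod (snd P (coord a)) * gnorm P"
    if "a \<in> carrier (lstalk X L x)" for a
    using lnorm_smult[OF P, folded x_def, OF gen_closed coord_closed[OF that]] coord_smult[OF that]
    by (simp add: gnorm_def x_def)
  have norm_list: "prod_list (map (lnorm L P) l) = cmod (snd P (coords l)) * gnorm P ^ length l"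
    if "l \<in> lists (carrier (lstalk X L x))" for l
    using that
  proof (induction l)
    case (Cons a l)
    then have "a \<in> carrier (lstalk X L x)" "l \<in> lists (carrier (lstalk X L x))" by auto
    with Cons.IH show ?case by (simp add: lnorm_coord hom norm_mult)
  qed (simp add: hom)
  have norm_single: "cmod (snd P c) * prod_list (map (lnorm L P) l) = cmod (tval P s) * gnorm P ^ n"
    if cl: "[(c, l)] \<in> s x" for c l
  proof -
    have c: "c \<in> carrier (stalk X x)" "l \<in> lists (carrier (lstalk X L x))" "length l = n"
      and ev: "teval [(c, l)] = teval E"
      using cl E by (auto simp: tclass_eq)
    have "tval P s = snd P c * snd P (coords l)"
      using ev c by (simp add: val hom flip: ev)
    then show ?thesis
      using c by (simp add: norm_list norm_mult)
  qed
  define g where "g = lgerm X (tpow X L n) x (topspace T) s"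
  have self: "(topspace T, s) \<in> g"
    unfolding g_def lgerm_def using x s by (auto intro: germ_self)
  \<comment> \<open>Restriction of tensor sections is restriction of functions, so sections with
    equal germs at \<open>x\<close> have the same value at \<open>x\<close>.\<close>
  have val_x: "t x = s x" if Vt: "(V, t) \<in> g" for V t
  proof -
    obtain W where "x \<in> W" "restrict s W = restrict t W"
      using Vt unfolding g_def lgerm_def germ_def by (auto simp: tpow_def)
    then show ?thesis by (metis restrict_apply')
  qed
  \<comment> \<open>The normal form supplies a pure tensor in the class; without one the description
    would have no solution.\<close>
  have E0: "[(teval E, replicate n (gen x))] \<in> s x"
    unfolding E(2) tclass_def using tensor_eq_normal[OF E(1)] by simp
  have "(THE r. \<exists>(V, t)\<in>g. \<exists>c l. [(c, l)] \<in> t (fst P) \<and>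
      r = cmod (snd P c) * prod_list (map (lnorm L P) l)) = cmod (tval P s) * gnorm P ^ n"
  proof (rule the_equality)
    show "\<exists>(V, t)\<in>g. \<exists>c l. [(c, l)] \<in> t (fst P) \<and>
      cmod (tval P s) * gnorm P ^ n = cmod (snd P c) * prod_list (map (lnorm L P) l)"
      using self E0 norm_single[OF E0] unfolding x_def by force
    fix r assume "\<exists>(V, t)\<in>g. \<exists>c l. [(c, l)] \<in> t (fst P) \<and>
      r = cmod (snd P c) * prod_list (map (lnorm L P) l)"
    then show "r = cmod (tval P s) * gnorm P ^ n"
      using val_x norm_single unfolding x_def by fastforce
  qed
  then show ?thesis
    by (simp add: tpow_def g_def x_def)
qed

text \<open>A supremum in \<open>ennreal\<close> is at most 1 exactly when every term is, and
  twisting changes neither sections nor germs, only the factor \<open>exp (- a)\<close>.\<close>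

lemma small_sections_twist:
  "s \<in> small_sections X (twist a (tpow X L n)) \<longleftrightarrow>
    s \<in> carrier (\<Gamma> n) \<and> (\<forall>P\<in>cpoints X. cmod (tval P s) * gnorm P ^ n \<le> exp a)"
proof -
  have sec: "lsec (twist a (tpow X L n)) = lsec (tpow X L n)"
    by (simp add: twist_def)
  have germ: "lgerm X (twist a (tpow X L n)) = lgerm X (tpow X L n)"
    by (simp add: twist_def lgerm_def)
  have nrm: "lnorm (twist a (tpow X L n)) P t = exp (- a) * lnorm (tpow X L n) P t" for P t
    by (simp add: twist_def)
  have "exp (- a) * r \<le> 1 \<longleftrightarrow> r \<le> exp a" for r
    by (simp add: exp_minus field_simps)
  then show ?thesis
    unfolding small_sections_def mem_Collect_eq sec germ nrm SUP_le_iff ennreal_le_1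
    by (cases "s \<in> carrier (\<Gamma> n)") (simp_all add: lnorm_tpow)
qed

lemma small_sections_tpow:
  "s \<in> small_sections X (tpow X L n) \<longleftrightarrow>
    s \<in> carrier (\<Gamma> n) \<and> (\<forall>P\<in>cpoints X. cmod (tval P s) * gnorm P ^ n \<le> 1)"
proof -
  have "twist 0 (tpow X L n) = tpow X L n"
    by (simp add: twist_def)
  then show ?thesis
    using small_sections_twist[of s 0 n] by simp
qed

lemma tval_finsum:
  assumes P: "P \<in> cpoints X" and "\<And>j. j \<in> J \<Longrightarrow> f j \<in> carrier (\<Gamma> n)" and "finite J"
  shows "tval P (\<Oplus>\<^bsub>\<Gamma> n\<^esub>j\<in>J. f j) = (\<Sum>j\<in>J. tval P (f j))"
proof -
  interpret G: abelian_group "\<Gamma> n" by (rule tsections_abelian_group)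
  show ?thesis
    using assms(3,2)
  proof (induction J)
    case (insert j J)
    then have f: "f \<in> J \<rightarrow> carrier (\<Gamma> n)" and fj: "f j \<in> carrier (\<Gamma> n)" by auto
    show ?case
      using insert tval_add[OF P fj G.finsum_closed[OF f]] G.finsum_insert[OF insert(1,2) f fj]
      by simp
  qed (simp add: tval_zero[OF P])
qed

text \<open>The triangle inequality costs a factor \<open>N\<close>, one for each term of the row,
  which the bound \<open>1 / N\<close> on the entries cancels.\<close>

lemma row_times_small:
  assumes a: "\<And>j. j < N \<Longrightarrow> a j \<in> small_sections X (twist (- ln (real N)) (tpow X L h))"
    and v: "\<And>j. j < N \<Longrightarrow> v j \<in> small_sections X (tpow X L b)" and N: "0 < N"
  shows "(\<Oplus>\<^bsub>\<Gamma> (h + b)\<^esub>j\<in>{..<N}. tprod X L h b (a j) (v j)) \<in> small_sections X (tpow X L (h + b))"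
  unfolding small_sections_tpow
proof (intro conjI ballI)
  interpret G: abelian_group "\<Gamma> (h + b)" by (rule tsections_abelian_group)
  have a': "a j \<in> carrier (\<Gamma> h)" and v': "v j \<in> carrier (\<Gamma> b)" if "j < N" for j
    using a[OF that] v[OF that] by (simp_all add: small_sections_twist small_sections_tpow)
  then have cl: "tprod X L h b (a j) (v j) \<in> carrier (\<Gamma> (h + b))" if "j < N" for j
    using that tprod_closed by blast
  then show "(\<Oplus>\<^bsub>\<Gamma> (h + b)\<^esub>j\<in>{..<N}. tprod X L h b (a j) (v j)) \<in> carrier (\<Gamma> (h + b))"
    by (intro G.finsum_closed) auto
  fix P assume P: "P \<in> cpoints X"
  have "cmod (tval P (\<Oplus>\<^bsub>\<Gamma> (h + b)\<^esub>j\<in>{..<N}. tprod X L h b (a j) (v j))) * gnorm P ^ (h + b) =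
      cmod (\<Sum>j<N. tval P (a j) * tval P (v j)) * gnorm P ^ (h + b)"
    using tval_finsum[OF P, of "{..<N}" "\<lambda>j. tprod X L h b (a j) (v j)" "h + b"] cl a' v'
    by (simp add: tval_tprod[OF P])
  also have "\<dots> \<le> (\<Sum>j<N. cmod (tval P (a j) * tval P (v j))) * gnorm P ^ (h + b)"
    using gnorm_nonneg[OF P] by (intro mult_right_mono norm_sum) auto
  \<comment> \<open>The power of \<open>gnorm P\<close> splits as \<open>h + b\<close>, giving each
    factor of the product its own norm.\<close>
  also have "\<dots> = (\<Sum>j<N. (cmod (tval P (a j)) * gnorm P ^ h) * (cmod (tval P (v j)) * gnorm P ^ b))"
    by (simp add: sum_distrib_left norm_mult power_add mult_ac)
  also have "\<dots> \<le> (\<Sum>j<N. (1 / real N) * 1)"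
  proof (intro sum_mono mult_mono)
    fix j assume "j \<in> {..<N}"
    then have j: "j < N" by simp
    show "cmod (tval P (a j)) * gnorm P ^ h \<le> 1 / real N"
      using a[OF j] P N by (simp add: small_sections_twist exp_minus inverse_eq_divide)
    show "cmod (tval P (v j)) * gnorm P ^ b \<le> 1"
      using v[OF j] P by (simp add: small_sections_tpow)
  qed (use gnorm_nonneg[OF P] in auto)
  also have "\<dots> = 1" using N by simp
  finally show "cmod (tval P (\<Oplus>\<^bsub>\<Gamma> (h + b)\<^esub>j\<in>{..<N}. tprod X L h b (a j) (v j))) *
      gnorm P ^ (h + b) \<le> 1" .
qed

text \<open>The bound 2 is \<open>1 + 1\<close> from the triangle inequality, whence the twist by
  \<open>ln 2\<close>.\<close>

lemma minus_small:
  assumes s: "s \<in> small_sections X (tpow X L n)" and t: "t \<in> small_sections X (tpow X L n)"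
  shows "s \<ominus>\<^bsub>\<Gamma> n\<^esub> t \<in> small_sections X (twist (ln 2) (tpow X L n))"
  unfolding small_sections_twist
proof (intro conjI ballI)
  interpret G: abelian_group "\<Gamma> n" by (rule tsections_abelian_group)
  have s': "s \<in> carrier (\<Gamma> n)" and t': "t \<in> carrier (\<Gamma> n)"
    using s t by (simp_all add: small_sections_tpow)
  then show "s \<ominus>\<^bsub>\<Gamma> n\<^esub> t \<in> carrier (\<Gamma> n)" by simp
  fix P assume P: "P \<in> cpoints X"
  have "cmod (tval P s - tval P t) * gnorm P ^ n \<le> (cmod (tval P s) + cmod (tval P t)) * gnorm P ^ n"
    using gnorm_nonneg[OF P] by (intro mult_right_mono norm_triangle_ineq4) auto
  also have "\<dots> \<le> 2"
    using s t P by (simp add: small_sections_tpow distrib_right) (smt (verit))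
  finally show "cmod (tval P (s \<ominus>\<^bsub>\<Gamma> n\<^esub> t)) * gnorm P ^ n \<le> exp (ln 2)"
    by (simp add: tval_minus[OF P s' t'])
qed

text \<open>Vectors are modelled by \<open>PiE\<close>, which makes them determined by their entries
  at the valid indices and gives the two cardinalities as powers.\<close>

lemma siegel_pigeonhole:
  assumes A: "\<And>i j. i < M \<Longrightarrow> j < N \<Longrightarrow>
      A i j \<in> small_sections X (twist (- ln (real N)) (tpow X L h))"
    and N: "0 < N"
    and fin: "finite (small_sections X (tpow X L (h + b)))"
    and card: "card (small_sections X (tpow X L (h + b))) ^ M < card (small_sections X (tpow X L b)) ^ N"
  shows "\<exists>v. (\<forall>j<N. v j \<in> small_sections X (twist (ln 2) (tpow X L b))) \<and>
    (\<exists>j<N. v j \<noteq> \<zero>\<^bsub>\<Gamma> b\<^esub>) \<and>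
    (\<forall>i<M. (\<Oplus>\<^bsub>\<Gamma> (h + b)\<^esub>j\<in>{..<N}. tprod X L h b (A i j) (v j)) = \<zero>\<^bsub>\<Gamma> (h + b)\<^esub>)"
proof -
  interpret G: abelian_group "\<Gamma> (h + b)" by (rule tsections_abelian_group)
  interpret Gb: abelian_group "\<Gamma> b" by (rule tsections_abelian_group)
  define S where "S = small_sections X (tpow X L b)"
  define S' where "S' = small_sections X (tpow X L (h + b))"
  define f where "f v = (\<lambda>i\<in>{..<M}. \<Oplus>\<^bsub>\<Gamma> (h + b)\<^esub>j\<in>{..<N}. tprod X L h b (A i j) (v j))" for v
  have "f ` PiE {..<N} (\<lambda>_. S) \<subseteq> PiE {..<M} (\<lambda>_. S')"
  proof (intro image_subsetI PiE_I)
    fix v i assume v: "v \<in> PiE {..<N} (\<lambda>_. S)" and i: "i \<in> {..<M}"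
    show "f v i \<in> S'"
      using i v A N row_times_small[of N "A i" h v b] by (auto simp: f_def S_def S'_def PiE_mem)
  qed (auto simp: f_def)
  moreover have "card (PiE {..<M} (\<lambda>_. S')) < card (PiE {..<N} (\<lambda>_. S))"
    using card by (simp add: card_PiE S_def S'_def)
  \<comment> \<open>An injection into the finite set of target vectors would bound the source
    cardinality by the smaller target cardinality.\<close>
  ultimately have "\<not> inj_on f (PiE {..<N} (\<lambda>_. S))"
    using card_inj_on_le[of f "PiE {..<N} (\<lambda>_. S)" "PiE {..<M} (\<lambda>_. S')"] fin
    by (auto simp: S'_def finite_PiE)
  then obtain v w where vw: "v \<in> PiE {..<N} (\<lambda>_. S)" "w \<in> PiE {..<N} (\<lambda>_. S)" "f v = f w" "v \<noteq> w"
    by (auto simp: inj_on_def)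
  have S: "v j \<in> S" "w j \<in> S" if "j < N" for j using vw that by auto
  then have cl: "v j \<in> carrier (\<Gamma> b)" "w j \<in> carrier (\<Gamma> b)" if "j < N" for j
    using that by (auto simp: S_def small_sections_tpow)
  have Acl: "A i j \<in> carrier (\<Gamma> h)" if "i < M" "j < N" for i j
    using A[OF that] by (simp add: small_sections_twist)
  \<comment> \<open>The difference is used in the form \<open>v = u + w\<close>, so that additivity
    in the second factor followed by cancellation of \<open>A w\<close> gives
    \<open>A u = 0\<close>.\<close>
  define u where "u j = v j \<ominus>\<^bsub>\<Gamma> b\<^esub> w j" for j
  have u: "u j \<in> carrier (\<Gamma> b)" "v j = u j \<oplus>\<^bsub>\<Gamma> b\<^esub> w j" if "j < N" for j
    using cl[OF that] by (simp_all add: u_def Gb.minus_eq Gb.a_assoc Gb.l_neg)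
  show ?thesis
  proof (intro exI[of _ u] conjI allI impI)
    show "u j \<in> small_sections X (twist (ln 2) (tpow X L b))" if "j < N" for j
      using S[OF that] unfolding u_def S_def by (rule minus_small)
    obtain j where j: "j < N" "v j \<noteq> w j"
      using PiE_ext[OF vw(1,2)] vw(4) by auto
    then have "u j \<noteq> \<zero>\<^bsub>\<Gamma> b\<^esub>"
      using u[OF j(1)] cl[OF j(1)] by auto
    then show "\<exists>j<N. u j \<noteq> \<zero>\<^bsub>\<Gamma> b\<^esub>" using j by blast
    fix i assume i: "i < M"
    let ?sum = "\<lambda>v. \<Oplus>\<^bsub>\<Gamma> (h + b)\<^esub>j\<in>{..<N}. tprod X L h b (A i j) (v j)"
    have Pi: "(\<lambda>j. tprod X L h b (A i j) (u j)) \<in> {..<N} \<rightarrow> carrier (\<Gamma> (h + b))"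
      "(\<lambda>j. tprod X L h b (A i j) (w j)) \<in> {..<N} \<rightarrow> carrier (\<Gamma> (h + b))"
      using Acl[OF i] u(1) cl by (auto intro: tprod_closed)
    have "?sum v = (\<Oplus>\<^bsub>\<Gamma> (h + b)\<^esub>j\<in>{..<N}.
        tprod X L h b (A i j) (u j) \<oplus>\<^bsub>\<Gamma> (h + b)\<^esub> tprod X L h b (A i j) (w j))"
    proof (rule G.finsum_cong')
      show "tprod X L h b (A i j) (v j) =
          tprod X L h b (A i j) (u j) \<oplus>\<^bsub>\<Gamma> (h + b)\<^esub> tprod X L h b (A i j) (w j)"
        if "j \<in> {..<N}" for j
        using that tprod_add_right[OF Acl[OF i] u(1) cl(2), of j j j] u(2)[of j] by simp
    qed (use Pi in auto)
    also have "\<dots> = ?sum u \<oplus>\<^bsub>\<Gamma> (h + b)\<^esub> ?sum w"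
      by (rule G.finsum_addf[OF Pi])
    finally have "?sum v = ?sum u \<oplus>\<^bsub>\<Gamma> (h + b)\<^esub> ?sum w" .
    moreover have "?sum v = ?sum w"
      using fun_cong[OF vw(3), of i] i by (simp add: f_def)
    ultimately have "?sum u \<oplus>\<^bsub>\<Gamma> (h + b)\<^esub> ?sum w = ?sum w" by simp
    then show "?sum u = \<zero>\<^bsub>\<Gamma> (h + b)\<^esub>"
      using G.add.r_cancel_one[OF G.finsum_closed[OF Pi(2)] G.finsum_closed[OF Pi(1)]] by blast
  qed
qed

end

section \<open>From the growth of \<open>h0\<close> to the comparison of cardinalities\<close>

theorem theorem9p2:
  fixes B :: "('p, 'r) rspace"
    and \<M> :: "('p, 'r, 's) mlsheaf"
    and c11 c12 :: real
    and m0 :: int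
    and d h b M N :: nat
    and A :: "nat \<Rightarrow> nat \<Rightarrow> ('p, 'r, 's) tpow_section"
  assumes "arithmetic_variety B"
    and "krull_dim (rtop B) = enat (d + 1)"
    and "smoothly_metrized_line_sheaf B \<M>"
    and "0 < c11" and "c11 < c12"
    and "\<forall>m\<ge>m0. c11 * real_of_int m ^ (d + 1) \<le> h0_pow B \<M> m \<and>
                 h0_pow B \<M> m \<le> c12 * real_of_int m ^ (d + 1)"
    and "0 < h" and "0 < b" and "0 < M" and "0 < N"
    and "\<forall>i<M. \<forall>j<N. A i j \<in> small_sections B (twist (- ln (real N)) (tpow B \<M> h))"
    and "m0 \<le> int b"
    and "(1 + real h / real b) ^ (d + 1) < (real N * c11) / (real M * c12)"
  shows "\<exists>v :: nat \<Rightarrow> ('p, 'r, 's) tpow_section.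
           (\<forall>j<N. v j \<in> small_sections B (twist (ln 2) (tpow B \<M> b))) \<and>
           (\<exists>j<N. v j \<noteq> \<zero>\<^bsub>lsec (tpow B \<M> b) (topspace (rtop B))\<^esub>) \<and>
           (\<forall>i<M. (\<Oplus>\<^bsub>lsec (tpow B \<M> (h + b)) (topspace (rtop B))\<^esub>j\<in>{..<N}.
                      tprod B \<M> h b (A i j) (v j)) =
                   \<zero>\<^bsub>lsec (tpow B \<M> (h + b)) (topspace (rtop B))\<^esub>)"
proof -
  interpret metrized_line_sheaf_on B \<M>
    using assms(1,3) unfolding arithmetic_variety_def integral_scheme_def scheme_def
      smoothly_metrized_line_sheaf_def
    by unfold_locales (auto simp: smoothly_metrized_line_sheaf_def)
  define n where "n k = card (small_sections B (tpow B \<M> k))" for k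
  \<comment> \<open>For \<open>k \<ge> b\<close> the index is at least \<open>m0\<close> and
    nonnegative, so \<open>h0_pow\<close> is \<open>h0\<close> of the tensor power itself and not of
    a power of the dual.\<close>
  have bounds: "c11 * real k ^ (d + 1) \<le> ln (real (n k))" "ln (real (n k)) \<le> c12 * real k ^ (d + 1)"
    if "b \<le> k" for k
    using assms(6,12) that spec[OF assms(6), of "int k"] by (auto simp: h0_pow_def h0_def n_def)
  \<comment> \<open>An infinite set has \<open>card\<close> 0, and \<open>ln 0 = 0\<close> here. The
    strictly positive lower bound therefore excludes infinite sets of small sections;
    \<open>0 < b\<close> makes it strict.\<close>
  have pos: "0 < n k" if "b \<le> k" for k
  proof -
    have "0 < c11 * real k ^ (d + 1)"
      using assms(4,8) that by simp
    then have "ln (real (n k)) > 0" using bounds(1)[OF that] by linarith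
    then show ?thesis by (cases "n k = 0") auto
  qed
  have "real M * ln (real (n (h + b))) \<le> real M * (c12 * real (h + b) ^ (d + 1))"
    using bounds(2)[of "h + b"] by (intro mult_left_mono) auto
  also have "\<dots> = real M * c12 * (1 + real h / real b) ^ (d + 1) * real b ^ (d + 1)"
  proof -
    have "real (h + b) = (1 + real h / real b) * real b"
      using assms(8) by (simp add: field_simps)
    then show ?thesis by (simp only: power_mult_distrib mult.assoc)
  qed
  \<comment> \<open>The assumed inequality multiplied by \<open>M * c12\<close>, positive since
    \<open>0 < c11 < c12\<close>, and then by the positive power of \<open>b\<close>.\<close>
  also have "\<dots> < real N * c11 * real b ^ (d + 1)"
    using assms(4,5,8,9,13) by (intro mult_strict_right_mono) (simp_all add: field_simps)
  also have "\<dots> \<le> real N * ln (real (n b))"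
    using mult_left_mono[OF bounds(1)[of b], of "real N"] by (simp add: mult.assoc)
  finally have "ln (real (n (h + b)) ^ M) < ln (real (n b) ^ N)"
    using pos by (simp add: ln_realpow)
  \<comment> \<open>Logarithms can be removed because both counts are positive.\<close>
  then have "real (n (h + b)) ^ M < real (n b) ^ N"
    using pos[of b] pos[of "h + b"] by simp
  then have "n (h + b) ^ M < n b ^ N"
    by (metis of_nat_less_iff of_nat_power)
  moreover have "finite (small_sections B (tpow B \<M> (h + b)))"
    using pos[of "h + b"] card_ge_0_finite by (simp add: n_def)
  ultimately show ?thesis
    using assms(10,11) by (intro siegel_pigeonhole) (auto simp: n_def)
qed

end
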